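(* Let $\mathcal B,\mathcal B^*:\mathbb{C}[M_{n,n}]\to\mathbf{U}(gl(n))$ be the unique linear maps with $\mathcal B((S|T))=[S|T]$ and $\mathcal B^*((S|T)^* )=[S|T]^*$ for all Young tableaux $S,T$ on $\{1,\dots,n\}$ of the same shape. Then $\mathcal B,\mathcal B^*$ and the Koszul map $\mathcal K$ are linear isomorphisms, $\mathcal B=\mathcal K^{-1}$, $\mathcal B^*=\mathcal K^{-1}$, and hence $\mathcal B=\mathcal B^*$.
   Context: $\mathbb{C}[M_{n,n}]$: polynomial algebra in commuting indeterminates $(i|j)$, $1\le i,j\le n$. A Young tableau of shape $\lambda=(\lambda_1\ge\dots\ge\lambda_m>0)$ on an alphabet is a sequence of words $(\omega_1,\dots,\omega_m)$, $\ell(\omega_r)=\lambda_r$. Biproduct: $(i_1\cdots i_p|j_1\cdots j_p)=(-1)^{\binom p2}\det((i_r|j_s))$; *-biproduct: $(i_1\cdots i_p|j_1\cdots j_p)^*=\mathrm{per}((i_r|j_s))$. For $S=(\omega_1,\dots,\omega_m)$, $T=(\varpi_1,\dots,\varpi_m)$ of the same shape: $(S|T)=(-1)^{\sum_{k=2}^m\ell(\omega_k)(\ell(\varpi_1)+\cdots+\ell(\varpi_{k-1}))}\prod_r(\omega_r|\varpi_r)$ and $(S|T)^*=\prod_r(\omega_r|\varpi_r)^*$. Koszul map: $D^l_{ij}$ is the derivation of $\mathbb{C}[M_{n,n}]$ with $D^l_{ij}((h|k))=\delta_{jh}(i|k)$; $\rho_{ij}=D^l_{ij}+$ multiplication by $(i|j)$;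 $\tau:\mathbf{U}(gl(n))\to\mathrm{End}(\mathbb{C}[M_{n,n}])$ the algebra morphism with $\tau(e_{ij})=\rho_{ij}$; $\mathcal K(\mathbf P)=\tau(\mathbf P)(1)$. Virtual variables: $A_0=\{\alpha_1,\dots,\alpha_{m_0}\}$ (parity $0$), $A_1=\{\beta_1,\dots,\beta_{m_1}\}$ (parity $1$), $L=\{1,\dots,n\}$ (parity $1$), $m_0,m_1$ large; $gl(m_0|m_1+n)$ has homogeneous basis $e_{a,b}$ of parity $|a|+|b|$, superbracket $[e_{a,b},e_{c,d}]=\delta_{bc}e_{a,d}-(-1)^{(|a|+|b|)(|c|+|d|)}\delta_{ad}e_{c,b}$, and $\mathbf{U}(gl(n))\subset\mathbf{U}(gl(m_0|m_1+n))$. A product $e_{a_m,b_m}\cdots e_{a_1,b_1}$ is irregular if for some $i\le m$ and virtual $\gamma$, $\#\{j\le i:b_j=\gamma\}>\#\{j<i:a_j=\gamma\}$; $\mathbf{Irr}$ is the left ideal they generate; it is known $Virt=\mathbf{U}(gl(n))\oplus\mathbf{Irr}$ is a subalgebra with $\mathbf{Irr}$ a two-sided ideal; $\mathfrak p:Virt\to\mathbf{U}(gl(n))$ is the projection with kernel $\mathbf{Irr}$. $e_{S,T}$ is the product over rows (first to last, each row left to right) of $e_{s,t}$ for corresponding entries. For shape $\lambda$ with $m$ rows, $C_\lambda$ has $r$-th row $\alpha_r$ repeated $\lambda_r$ times and $D'_\lambda$ has $r$-th row $\beta_r$ repeated $\lambda_r$ times. $[S|T]=\mathfrak p(e_{S,C_\lambda}e_{C_\lambda,T})$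 and $[S|T]^*=\mathfrak p(e_{S,D'_\lambda}e_{D'_\lambda,T})$. *)

theory Defs
  imports Complex_Main "HOL-Library.Poly_Mapping" "HOL-Combinatorics.Permutations"
begin

text \<open>Polynomials in the commuting indeterminates (i|j): finitely supported
  maps from monomials (finitely supported exponent vectors on index pairs) to
  complex coefficients; multiplication is the convolution product of Poly_Mapping.\<close>

type_synonym cpoly = "((nat \<times> nat) \<Rightarrow>\<^sub>0 nat) \<Rightarrow>\<^sub>0 complex"

definition Var :: "nat \<Rightarrow> nat \<Rightarrow> cpoly" where
  "Var i j = Poly_Mapping.single (Poly_Mapping.single (i, j) 1) 1"

definition psc :: "complex \<Rightarrow> cpoly \<Rightarrow> cpoly" where
  "psc c p = Poly_Mapping.single 0 c * p"

definition Cpoly :: "nat \<Rightarrow> cpoly set" where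
  "Cpoly n = {p :: cpoly. \<forall>m\<in>Poly_Mapping.keys p. \<forall>v\<in>Poly_Mapping.keys m. fst v \<in> {1..n} \<and> snd v \<in> {1..n}}"

definition pd :: "nat \<times> nat \<Rightarrow> cpoly \<Rightarrow> cpoly" where
  "pd v p = (\<Sum>m\<in>Poly_Mapping.keys p. Poly_Mapping.single (m - Poly_Mapping.single v 1)
                              (of_nat (Poly_Mapping.lookup m v) * Poly_Mapping.lookup p m))"

text \<open>The derivation D^l_{ij}, with D^l_{ij}((h|k)) = delta_{jh} (i|k).\<close>
definition Dl :: "nat \<Rightarrow> nat \<Rightarrow> nat \<Rightarrow> cpoly \<Rightarrow> cpoly" where
  "Dl n i j p = (\<Sum>k\<in>{1..n}. Var i k * pd (j, k) p)"

definition rho :: "nat \<Rightarrow> nat \<Rightarrow> nat \<Rightarrow> cpoly \<Rightarrow> cpoly" where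
  "rho n i j p = Dl n i j p + Var i j * p"

text \<open>Alpha r: positive virtual letters (parity 0); Beta r: negative virtual
  letters (parity 1); Lt i: proper letters 1..n (parity 1).  The virtual
  alphabets are taken infinite (indexed by nat), which models "m_0, m_1 large".\<close>

datatype letter = Alpha nat | Beta nat | Lt nat

fun par :: "letter \<Rightarrow> nat" where
  "par (Alpha _) = 0" | "par (Beta _) = 1" | "par (Lt _) = 1"

fun virtual :: "letter \<Rightarrow> bool" where
  "virtual (Alpha _) = True" | "virtual (Beta _) = True" | "virtual (Lt _) = False"

fun valid_letter :: "nat \<Rightarrow> letter \<Rightarrow> bool" where
  "valid_letter n (Lt i) = (1 \<le> i \<and> i \<le> n)" | "valid_letter n _ = True"

text \<open>A generator (a,b) stands for e_{a,b}; a word [g1,...,gk] stands for the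
  product g1 g2 ... gk (left to right).\<close>
type_synonym gen = "letter \<times> letter"
type_synonym falg = "gen list \<Rightarrow>\<^sub>0 complex"

definition valid_word :: "nat \<Rightarrow> gen list \<Rightarrow> bool" where
  "valid_word n w = (\<forall>(a, b)\<in>set w. valid_letter n a \<and> valid_letter n b)"

definition fmul :: "falg \<Rightarrow> falg \<Rightarrow> falg" where
  "fmul x y = (\<Sum>u\<in>Poly_Mapping.keys x. \<Sum>v\<in>Poly_Mapping.keys y. Poly_Mapping.single (u @ v) (Poly_Mapping.lookup x u * Poly_Mapping.lookup y v))"

definition fsc :: "complex \<Rightarrow> falg \<Rightarrow> falg" where
  "fsc c x = fmul (Poly_Mapping.single [] c) x"

definition wd :: "gen list \<Rightarrow> falg" where
  "wd w = Poly_Mapping.single w 1"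

definition sgn_par :: "gen \<Rightarrow> gen \<Rightarrow> complex" where
  "sgn_par g h = (if odd ((par (fst g) + par (snd g)) * (par (fst h) + par (snd h))) then -1 else 1)"

text \<open>Defining relations of U(gl(m_0|m_1+n)):
  e_{ab} e_{cd} - s e_{cd} e_{ab} = delta_{bc} e_{ad} - s delta_{ad} e_{cb}.\<close>
definition relator :: "gen \<Rightarrow> gen \<Rightarrow> falg" where
  "relator g h = (case (g, h) of ((a, b), (c, d)) \<Rightarrow>
      wd [g, h] - fsc (sgn_par g h) (wd [h, g])
      - ((if b = c then wd [(a, d)] else 0) - fsc (sgn_par g h) (if a = d then wd [(c, b)] else 0)))"

text \<open>Two-sided ideal of the free algebra generated by the relators;
  U(gl(m_0|m_1+n)) is the quotient of the free algebra (on valid generators) by it.\<close>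
inductive_set Iid :: "nat \<Rightarrow> falg set" for n where
  zero: "0 \<in> Iid n"
| add: "x \<in> Iid n \<Longrightarrow> y \<in> Iid n \<Longrightarrow> x + y \<in> Iid n"
| scal: "x \<in> Iid n \<Longrightarrow> fsc c x \<in> Iid n"
| gen: "valid_word n u \<Longrightarrow> valid_word n v \<Longrightarrow> valid_word n [g, h] \<Longrightarrow>
          fmul (wd u) (fmul (relator g h) (wd v)) \<in> Iid n"

text \<open>U(gl(n)) inside U(gl(m_0|m_1+n)): (classes of) linear combinations of words in the
  generators e_{ij}, 1 <= i,j <= n.\<close>
definition Lspan :: "nat \<Rightarrow> falg set" where
  "Lspan n = {x. \<forall>w\<in>Poly_Mapping.keys x. \<forall>(a, b)\<in>set w.
      (\<exists>i j. a = Lt i \<and> b = Lt j \<and> 1 \<le> i \<and> i \<le> n \<and> 1 \<le> j \<and> j \<le> n)}"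

text \<open>The word w = [g_m, ..., g_1] represents e_{a_m b_m} ... e_{a_1 b_1};
  reading rev w gives g_1, g_2, ...\<close>
definition irregular :: "gen list \<Rightarrow> bool" where
  "irregular w = (\<exists>i \<gamma>. 1 \<le> i \<and> i \<le> length w \<and> virtual \<gamma> \<and>
      length (filter (\<lambda>g. snd g = \<gamma>) (take i (rev w)))
        > length (filter (\<lambda>g. fst g = \<gamma>) (take (i - 1) (rev w))))"

text \<open>Preimage in the free algebra of the left ideal Irr generated by irregular products.\<close>
inductive_set Irr :: "nat \<Rightarrow> falg set" for n where
  ideal: "x \<in> Iid n \<Longrightarrow> x \<in> Irr n"
| add: "x \<in> Irr n \<Longrightarrow> y \<in> Irr n \<Longrightarrow> x + y \<in> Irr n"
| scal: "x \<in> Irr n \<Longrightarrow> fsc c x \<in> Irr n"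
| gen: "valid_word n u \<Longrightarrow> valid_word n w \<Longrightarrow> irregular w \<Longrightarrow> wd (u @ w) \<in> Irr n"

text \<open>"u represents p(x)": u lies in U(gl(n)) and x - u lies in Irr; since
  Virt = U(gl(n)) (+) Irr, this determines the class of u uniquely.\<close>
definition represents_proj :: "nat \<Rightarrow> falg \<Rightarrow> falg \<Rightarrow> bool" where
  "represents_proj n x u = (u \<in> Lspan n \<and> x - u \<in> Irr n)"

fun rho_gen :: "nat \<Rightarrow> gen \<Rightarrow> cpoly \<Rightarrow> cpoly" where
  "rho_gen n (Lt i, Lt j) p = rho n i j p"
| "rho_gen n _ p = 0"

definition Kword :: "nat \<Rightarrow> gen list \<Rightarrow> cpoly" where
  "Kword n w = foldr (rho_gen n) w 1"

definition Kmap :: "nat \<Rightarrow> falg \<Rightarrow> cpoly" where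
  "Kmap n x = (\<Sum>w\<in>Poly_Mapping.keys x. psc (Poly_Mapping.lookup x w) (Kword n w))"

definition tableau_on :: "nat \<Rightarrow> nat list list \<Rightarrow> bool" where
  "tableau_on n S = ((\<forall>\<omega>\<in>set S. \<omega> \<noteq> [] \<and> set \<omega> \<subseteq> {1..n}) \<and>
                     sorted_wrt (\<ge>) (map length S))"

definition det_var :: "nat list \<Rightarrow> nat list \<Rightarrow> cpoly" where
  "det_var \<omega> \<pi> = (\<Sum>\<sigma>\<in>{\<sigma>. \<sigma> permutes {..<length \<omega>}}.
       of_int (sign \<sigma>) * (\<Prod>r<length \<omega>. Var (\<omega> ! r) (\<pi> ! (\<sigma> r))))"

definition per_var :: "nat list \<Rightarrow> nat list \<Rightarrow> cpoly" where
  "per_var \<omega> \<pi> = (\<Sum>\<sigma>\<in>{\<sigma>. \<sigma> permutes {..<length \<omega>}}.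
       (\<Prod>r<length \<omega>. Var (\<omega> ! r) (\<pi> ! (\<sigma> r))))"

definition biprod :: "nat list \<Rightarrow> nat list \<Rightarrow> cpoly" where
  "biprod \<omega> \<pi> = (-1) ^ (length \<omega> choose 2) * det_var \<omega> \<pi>"

definition bitab :: "nat list list \<Rightarrow> nat list list \<Rightarrow> cpoly" where
  "bitab S T = (-1) ^ (\<Sum>k<length S. length (S ! k) * (\<Sum>l<k. length (T ! l)))
                * (\<Prod>r<length S. biprod (S ! r) (T ! r))"

definition bitab_star :: "nat list list \<Rightarrow> nat list list \<Rightarrow> cpoly" where
  "bitab_star S T = (\<Prod>r<length S. per_var (S ! r) (T ! r))"

text \<open>The word of e_{S,V} e_{V,T}, where V has r-th row (r = 1..m) the virtual
  letter v r repeated lambda_r times (v = Alpha gives C_lambda, v = Beta gives D'_lambda).\<close>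
definition virt_word :: "(nat \<Rightarrow> letter) \<Rightarrow> nat list list \<Rightarrow> nat list list \<Rightarrow> gen list" where
  "virt_word v S T =
     concat (map (\<lambda>r. map (\<lambda>s. (Lt s, v (Suc r))) (S ! r)) [0..<length S]) @
     concat (map (\<lambda>r. map (\<lambda>t. (v (Suc r), Lt t)) (T ! r)) [0..<length T])"

text \<open>B is a linear map C[M_{n,n}] -> U(gl(n)) (given by representatives, linear
  modulo the defining ideal) with B(bt(S,T)) = p(e_{S,V} e_{V,T}) for all tableaux S,T
  on {1..n} of the same shape.\<close>
definition is_Bmap :: "nat \<Rightarrow> (nat \<Rightarrow> letter) \<Rightarrow> (nat list list \<Rightarrow> nat list list \<Rightarrow> cpoly)
                        \<Rightarrow> (cpoly \<Rightarrow> falg) \<Rightarrow> bool" where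
  "is_Bmap n v bt B =
     ((\<forall>p\<in>Cpoly n. B p \<in> Lspan n) \<and>
      (\<forall>p\<in>Cpoly n. \<forall>q\<in>Cpoly n. \<forall>c d.
          B (psc c p + psc d q) - (fsc c (B p) + fsc d (B q)) \<in> Iid n) \<and>
      (\<forall>S T. tableau_on n S \<longrightarrow> tableau_on n T \<longrightarrow> map length S = map length T \<longrightarrow>
          represents_proj n (wd (virt_word v S T)) (B (bt S T))))"

end

theory Submission
  imports Defs "HOL-Library.Function_Algebras" "HOL-Library.Nat_Bijection"
begin

text \<open>The Koszul representation extends to an action of the general linear Lie superalgebra on the
  supersymmetric algebra on the \<open>(a|k)\<close>, \<open>a\<close> any letter: \<open>e\<^bsub>a,b\<^esub>\<close> acts as the superderivation
  \<open>D\<^bsub>a,b\<^esub>\<close>, plus multiplication by \<open>(a|j)\<close> when \<open>b\<close> is the proper letter \<open>j\<close>. Irregular words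
  annihilate the vacuum \<open>1\<close> because they remove a virtual letter more often than it is present. Hence
  the Koszul map of a projection \<open>p(x)\<close> is \<open>x\<close> applied to the vacuum, and for \<open>x = e\<^bsub>S,V\<^esub> e\<^bsub>V,T\<^esub>\<close>
  this is a product of determinants (the \<open>(\<alpha>|k)\<close> anticommute) or permanents (the \<open>(\<beta>|k)\<close> commute). So every
  bitableau map is a right inverse of the Koszul map. The latter is bijective because the leading
  term of the image of a word is its commutative monomial, while words with equal monomials
  are permutations of each other and thus agree modulo shorter words.\<close>

section \<open>Linear extension\<close>

text \<open>No Poincare-Birkhoff-Witt theorem, straightening law or decomposition of
  \<open>Virt\<close> is presupposed. An element of \<open>Lspan n\<close> may lie in
  \<open>Iid n\<close> through relators that involve virtual letters, so even the well-definedness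
  of the Koszul map on U(gl(n)) requires an action of the whole superalgebra; this is what the Fock
  space supplies. Uniqueness of the projection then follows from injectivity of the Koszul map
  modulo \<open>Iid n\<close>, since any two representatives have the same Koszul image. Its
  existence is a separate matter, settled by a rewriting argument on words. Existence of
  \<open>B\<close> is not shown by checking the linear relations between bitableaux:
  \<open>B\<close> is an arbitrary section of the Koszul map, and its values on all bitableaux come
  out right by uniqueness. Conversely, a given \<open>B\<close> is pinned down by the bitableaux
  with one column, which already span. The signs in the definition of a bitableau are exactly those
  of exchanging odd objects, inside a row and between rows.\<close>

lemma poly_mapping_expand:
  "x = (\<Sum>w\<in>Poly_Mapping.keys x. Poly_Mapping.single w (Poly_Mapping.lookup x w))"
proof (rule poly_mapping_eqI)
  fix k
  have "(\<Sum>w\<in>Poly_Mapping.keys x. Poly_Mapping.lookup (Poly_Mapping.single w (Poly_Mapping.lookup x w)) k)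
     = (\<Sum>w\<in>Poly_Mapping.keys x. if k = w then Poly_Mapping.lookup x w else 0)"
    by (intro sum.cong) (auto simp: lookup_single)
  also have "\<dots> = Poly_Mapping.lookup x k"
    by (simp add: sum.delta' in_keys_iff)
  finally show "Poly_Mapping.lookup x k
      = Poly_Mapping.lookup (\<Sum>w\<in>Poly_Mapping.keys x. Poly_Mapping.single w (Poly_Mapping.lookup x w)) k"
    by (simp add: lookup_sum)
qed

lemma additive_eqI:
  fixes f g :: "('a \<Rightarrow>\<^sub>0 'b::ab_group_add) \<Rightarrow> 'c::ab_group_add"
  assumes "additive f" "additive g"
    and single: "\<And>m c. f (Poly_Mapping.single m c) = g (Poly_Mapping.single m c)"
  shows "f x = g x"
proof -
  have "f x = (\<Sum>w\<in>Poly_Mapping.keys x. f (Poly_Mapping.single w (Poly_Mapping.lookup x w)))"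
    using additive.sum[OF assms(1)] poly_mapping_expand[of x] by metis
  also have "\<dots> = (\<Sum>w\<in>Poly_Mapping.keys x. g (Poly_Mapping.single w (Poly_Mapping.lookup x w)))"
    by (simp add: single)
  also have "\<dots> = g x"
    using additive.sum[OF assms(2)] poly_mapping_expand[of x] by metis
  finally show ?thesis .
qed

lemma additive_comp: "additive f \<Longrightarrow> additive g \<Longrightarrow> additive (\<lambda>x. f (g x))"
  by (simp add: additive_def)

lemma psc_one [simp]: "psc 1 p = p"
  by (simp add: psc_def)

lemma psc_zero [simp]: "psc 0 p = 0"
  by (simp add: psc_def)

lemma psc_zero_right [simp]: "psc c 0 = 0"
  by (simp add: psc_def)

lemma psc_add_left: "psc (c + d) p = psc c p + psc d p"
  by (simp add: psc_def single_add distrib_right)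

lemma psc_add_right: "psc c (p + q) = psc c p + psc c q"
  by (simp add: psc_def distrib_left)

lemma psc_psc: "psc c (psc d p) = psc (c * d) p"
  by (simp add: psc_def mult_single flip: mult.assoc)

lemma psc_minus_one: "psc (-1) p = - p"
  by (simp add: psc_def single_uminus)

lemma psc_single: "psc c (Poly_Mapping.single m d) = Poly_Mapping.single m (c * d)"
  by (simp add: psc_def mult_single)

lemma lookup_psc [simp]: "Poly_Mapping.lookup (psc c p) m = c * Poly_Mapping.lookup p m"
proof -
  have "psc c p = psc c (\<Sum>w\<in>Poly_Mapping.keys p. Poly_Mapping.single w (Poly_Mapping.lookup p w))"
    using poly_mapping_expand[of p] by simp
  also have "\<dots> = (\<Sum>w\<in>Poly_Mapping.keys p. Poly_Mapping.single w (c * Poly_Mapping.lookup p w))"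
    by (simp add: psc_def sum_distrib_left mult_single)
  finally have "Poly_Mapping.lookup (psc c p) m
      = (\<Sum>w\<in>Poly_Mapping.keys p. if m = w then c * Poly_Mapping.lookup p w else 0)"
    by (simp add: lookup_sum lookup_single when_def eq_commute)
  then show ?thesis
    by (simp add: sum.delta' in_keys_iff)
qed

definition lin :: "(gen list \<Rightarrow> cpoly) \<Rightarrow> falg \<Rightarrow> cpoly" where
  "lin \<phi> x = (\<Sum>w\<in>Poly_Mapping.keys x. psc (Poly_Mapping.lookup x w) (\<phi> w))"

lemma Kmap_lin: "Kmap n = lin (Kword n)"
  by (simp add: Kmap_def lin_def fun_eq_iff)

lemma lin_superset:
  assumes "finite A" "Poly_Mapping.keys x \<subseteq> A"
  shows "lin \<phi> x = (\<Sum>w\<in>A. psc (Poly_Mapping.lookup x w) (\<phi> w))"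
  unfolding lin_def using assms
  by (intro sum.mono_neutral_left) (auto simp: in_keys_iff)

lemma lin_add: "lin \<phi> (x + y) = lin \<phi> x + lin \<phi> y"
proof -
  let ?A = "Poly_Mapping.keys x \<union> Poly_Mapping.keys y"
  have "lin \<phi> (x + y) = (\<Sum>w\<in>?A. psc (Poly_Mapping.lookup (x + y) w) (\<phi> w))"
    by (rule lin_superset) (auto simp: keys_add)
  also have "\<dots> = (\<Sum>w\<in>?A. psc (Poly_Mapping.lookup x w) (\<phi> w)) + (\<Sum>w\<in>?A. psc (Poly_Mapping.lookup y w) (\<phi> w))"
    by (simp add: lookup_add psc_add_left sum.distrib)
  also have "\<dots> = lin \<phi> x + lin \<phi> y"
    using lin_superset[of ?A x \<phi>] lin_superset[of ?A y \<phi>] by simp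
  finally show ?thesis .
qed

lemma additive_lin: "additive (lin \<phi>)"
  by (simp add: additive_def lin_add)

lemma lin_zero [simp]: "lin \<phi> 0 = 0"
  by (simp add: lin_def)

lemma lin_diff: "lin \<phi> (x - y) = lin \<phi> x - lin \<phi> y"
  by (rule additive.diff[OF additive_lin])

lemma lin_single: "lin \<phi> (Poly_Mapping.single w c) = psc c (\<phi> w)"
  by (simp add: lin_superset[of "{w}"])

lemma lin_wd [simp]: "lin \<phi> (wd w) = \<phi> w"
  by (simp add: wd_def lin_single)

lemma fsc_eq_sum:
  "fsc c x = (\<Sum>v\<in>Poly_Mapping.keys x. Poly_Mapping.single v (c * Poly_Mapping.lookup x v))"
  by (cases "c = 0") (simp_all add: fsc_def fmul_def)

lemma lookup_fsc [simp]: "Poly_Mapping.lookup (fsc c x) w = c * Poly_Mapping.lookup x w"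
proof -
  have "Poly_Mapping.lookup (fsc c x) w
      = (\<Sum>v\<in>Poly_Mapping.keys x. if w = v then c * Poly_Mapping.lookup x v else 0)"
    by (simp add: fsc_eq_sum lookup_sum lookup_single when_def eq_commute)
  then show ?thesis
    by (simp add: sum.delta' in_keys_iff)
qed

lemma fsc_add_right: "fsc c (x + y) = fsc c x + fsc c y"
  by (rule poly_mapping_eqI) (simp add: lookup_add distrib_left)

lemma fsc_diff_right: "fsc c (x - y) = fsc c x - fsc c y"
  by (rule poly_mapping_eqI) (simp add: lookup_minus right_diff_distrib)

lemma fsc_zero_right [simp]: "fsc c 0 = 0"
  by (rule poly_mapping_eqI) simp

lemma fsc_zero [simp]: "fsc 0 x = 0"
  by (rule poly_mapping_eqI) simp

lemma fsc_one [simp]: "fsc 1 x = x"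
  by (rule poly_mapping_eqI) simp

lemma fsc_minus_one: "fsc (-1) x = - x"
  by (rule poly_mapping_eqI) simp

lemma fsc_single: "fsc c (Poly_Mapping.single w d) = Poly_Mapping.single w (c * d)"
  by (rule poly_mapping_eqI) (simp add: lookup_single when_def)

lemma fsc_wd: "fsc c (wd w) = Poly_Mapping.single w c"
  by (simp add: wd_def fsc_single)

lemma falg_expand: "x = (\<Sum>w\<in>Poly_Mapping.keys x. fsc (Poly_Mapping.lookup x w) (wd w))"
  using poly_mapping_expand[of x] by (simp add: fsc_wd)

lemma lin_fsc: "lin \<phi> (fsc c x) = psc c (lin \<phi> x)"
  by (rule additive_eqI[of "\<lambda>x. lin \<phi> (fsc c x)" "\<lambda>x. psc c (lin \<phi> x)"])
     (simp_all add: additive_def fsc_add_right lin_add psc_add_right fsc_single lin_single psc_psc)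

section \<open>Multiplication by a word on either side\<close>

lemma fmul_wd_left: "fmul (wd u) x = (\<Sum>v\<in>Poly_Mapping.keys x. Poly_Mapping.single (u @ v) (Poly_Mapping.lookup x v))"
  by (simp add: fmul_def wd_def)

lemma fmul_wd_right: "fmul x (wd v) = (\<Sum>u\<in>Poly_Mapping.keys x. Poly_Mapping.single (u @ v) (Poly_Mapping.lookup x u))"
  by (simp add: fmul_def wd_def)

lemma sum_keys_superset:
  fixes x :: "'a \<Rightarrow>\<^sub>0 'b::comm_monoid_add"
  assumes "finite A" "Poly_Mapping.keys x \<subseteq> A"
  shows "(\<Sum>w\<in>Poly_Mapping.keys x. Poly_Mapping.single (k w) (Poly_Mapping.lookup x w))
       = (\<Sum>w\<in>A. Poly_Mapping.single (k w) (Poly_Mapping.lookup x w))"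
  using assms by (intro sum.mono_neutral_left) (auto simp: in_keys_iff)

lemma sum_keys_single_add:
  fixes x y :: "'a \<Rightarrow>\<^sub>0 'b::comm_monoid_add"
  shows "(\<Sum>w\<in>Poly_Mapping.keys (x + y). Poly_Mapping.single (k w) (Poly_Mapping.lookup (x + y) w))
    = (\<Sum>w\<in>Poly_Mapping.keys x. Poly_Mapping.single (k w) (Poly_Mapping.lookup x w))
    + (\<Sum>w\<in>Poly_Mapping.keys y. Poly_Mapping.single (k w) (Poly_Mapping.lookup y w))"
proof -
  let ?A = "Poly_Mapping.keys x \<union> Poly_Mapping.keys y"
  show ?thesis
    using sum_keys_superset[of ?A "x + y" k] sum_keys_superset[of ?A x k] sum_keys_superset[of ?A y k]
    by (simp add: keys_add lookup_add single_add sum.distrib)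
qed

lemma additive_fmul_wd_left: "additive (fmul (wd u))"
  by (simp add: additive_def fmul_wd_left sum_keys_single_add)

lemma additive_fmul_wd_right: "additive (\<lambda>x. fmul x (wd v))"
  by (simp add: additive_def fmul_wd_right sum_keys_single_add)

lemma fmul_wd_left_single: "fmul (wd u) (Poly_Mapping.single v c) = Poly_Mapping.single (u @ v) c"
  by (cases "c = 0") (simp_all add: fmul_wd_left)

lemma fmul_wd_right_single: "fmul (Poly_Mapping.single u c) (wd v) = Poly_Mapping.single (u @ v) c"
  by (cases "c = 0") (simp_all add: fmul_wd_right)

lemma fmul_relator:
  "fmul (wd u) (fmul (relator (a, b) (c, d)) (wd v)) =
     wd (u @ [(a, b), (c, d)] @ v) - fsc (sgn_par (a, b) (c, d)) (wd (u @ [(c, d), (a, b)] @ v))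
     - ((if b = c then wd (u @ [(a, d)] @ v) else 0)
        - fsc (sgn_par (a, b) (c, d)) (if a = d then wd (u @ [(c, b)] @ v) else 0))"
proof -
  note l = additive.diff[OF additive_fmul_wd_left] additive.zero[OF additive_fmul_wd_left]
  note r = additive.diff[OF additive_fmul_wd_right] additive.zero[OF additive_fmul_wd_right]
  have *: "fmul (wd u) (fmul (Poly_Mapping.single w e) (wd v)) = Poly_Mapping.single (u @ w @ v) e" for w e
    by (simp add: fmul_wd_left_single fmul_wd_right_single)
  show ?thesis
    by (simp add: relator_def l r fsc_wd fsc_single * wd_def[of "[_]"] wd_def[of "[_, _]"] wd_def[of "_ @ _"])
qed

section \<open>Partial derivatives\<close>

lemma pd_add: "pd v (p + q) = pd v p + pd v q"
proof -
  have *: "pd v p = (\<Sum>m\<in>A. Poly_Mapping.single (m - Poly_Mapping.single v 1)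
                 (of_nat (Poly_Mapping.lookup m v) * Poly_Mapping.lookup p m))"
    if "finite A" "Poly_Mapping.keys p \<subseteq> A" for A p
    unfolding pd_def using that by (intro sum.mono_neutral_left) (auto simp: in_keys_iff)
  let ?A = "Poly_Mapping.keys p \<union> Poly_Mapping.keys q"
  show ?thesis
    using *[of ?A p] *[of ?A q] *[of ?A "p + q"]
    by (simp add: keys_add lookup_add single_add sum.distrib distrib_left)
qed

lemma additive_pd: "additive (pd v)"
  by (simp add: additive_def pd_add)

lemma pd_single:
  "pd v (Poly_Mapping.single m c)
   = Poly_Mapping.single (m - Poly_Mapping.single v 1) (of_nat (Poly_Mapping.lookup m v) * c)"
  by (cases "c = 0") (simp_all add: pd_def)

lemma pd_zero [simp]: "pd v 0 = 0"
  by (rule additive.zero[OF additive_pd])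

lemma pd_one [simp]: "pd v 1 = 0"
  using pd_single[of v 0 1] by simp

lemma pd_Var_mult:
  "pd v (Var i j * p) = (if v = (i, j) then p else 0) + Var i j * pd v p"
proof (rule additive_eqI[of "\<lambda>p. pd v (Var i j * p)" "\<lambda>p. (if v = (i, j) then p else 0) + Var i j * pd v p"])
  show "additive (\<lambda>p. pd v (Var i j * p))"
    by (simp add: additive_def distrib_left pd_add)
  show "additive (\<lambda>p. (if v = (i, j) then p else 0) + Var i j * pd v p)"
    by (simp add: additive_def distrib_left pd_add algebra_simps)
  fix m c
  show "pd v (Var i j * Poly_Mapping.single m c) =
      (if v = (i, j) then Poly_Mapping.single m c else 0) + Var i j * pd v (Poly_Mapping.single m c)"
  proof (cases "v = (i, j)")
    case False
    have "Poly_Mapping.single (i, j) 1 + m - Poly_Mapping.single v 1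
        = Poly_Mapping.single (i, j) 1 + (m - Poly_Mapping.single v (1::nat))"
      by (rule poly_mapping_eqI) (use False in \<open>auto simp: lookup_add lookup_minus lookup_single when_def\<close>)
    then show ?thesis
      using False by (simp add: Var_def mult_single pd_single lookup_add lookup_single)
  next
    case True
    \<comment> \<open>Subtraction of exponents truncates at 0, so restoring \<open>m\<close> needs a
      positive exponent of \<open>v\<close>; for exponent 0 the derivative of the monomial is killed
      by its coefficient.\<close>
    show ?thesis
    proof (cases "Poly_Mapping.lookup m v = 0")
      case 0: True
      show ?thesis
        using 0 True by (simp add: Var_def mult_single pd_single lookup_add lookup_single)
    next
      case False
      have "Poly_Mapping.single (i, j) 1 + (m - Poly_Mapping.single v (1::nat)) = m"
        by (rule poly_mapping_eqI) (use False True in \<open>auto simp: lookup_add lookup_minus lookup_single when_def\<close>)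
      then show ?thesis
        using True by (simp add: Var_def mult_single pd_single lookup_add lookup_single distrib_right single_add)
    qed
  qed
qed

lemma pd_commute: "pd u (pd v p) = pd v (pd u p)"
proof (rule additive_eqI[of "\<lambda>p. pd u (pd v p)" "\<lambda>p. pd v (pd u p)"])
  fix m and c :: complex
  have "m - Poly_Mapping.single v 1 - Poly_Mapping.single u 1
      = m - Poly_Mapping.single u 1 - Poly_Mapping.single v (1::nat)"
    by (rule poly_mapping_eqI) (simp add: lookup_minus)
  then show "pd u (pd v (Poly_Mapping.single m c)) = pd v (pd u (Poly_Mapping.single m c))"
    by (cases "u = v") (simp_all add: pd_single lookup_minus lookup_single when_def mult_ac)
qed (simp_all add: additive_def pd_add)

section \<open>Fock space\<close>

text \<open>The supersymmetric algebra on the variables \<open>(a|k)\<close>, \<open>a\<close> any letter: a vector assigns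
  to a set \<open>F\<close> of odd variables \<open>(\<alpha>\<^sub>r|k)\<close> (their product in increasing order) and an exponent
  function \<open>m\<close> of the variables \<open>(\<beta>\<^sub>r|k)\<close> a coefficient that is a polynomial in the \<open>(i|k)\<close>.
  Infinite sums are allowed, so that operators are given coefficientwise.\<close>

type_synonym fock = "(nat \<times> nat) set \<Rightarrow> (nat \<times> nat \<Rightarrow> nat) \<Rightarrow> cpoly"

text \<open>The Jordan--Wigner sign.\<close>
definition jw :: "nat \<times> nat \<Rightarrow> (nat \<times> nat) set \<Rightarrow> cpoly" where
  "jw q F = (-1) ^ card {p \<in> F. prod_encode p < prod_encode q}"

text \<open>The set \<open>F\<close> may be infinite, vectors being arbitrary functions; the
  Jordan-Wigner sign still counts a finite set because \<open>prod_encode\<close> is injective into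
  the naturals.\<close>

lemma finite_below: "finite {p \<in> F. prod_encode p < (N::nat)}"
proof -
  have "finite (prod_encode -` {..<N})"
    by (intro finite_vimageI inj_prod_encode) simp
  then show ?thesis
    by (rule rev_finite_subset) auto
qed

lemma jw_insert:
  assumes "q \<notin> F"
  shows "jw p (insert q F) = (if prod_encode q < prod_encode p then - jw p F else jw p F)"
proof -
  have "{r \<in> insert q F. prod_encode r < prod_encode p}
      = (if prod_encode q < prod_encode p then insert q {r \<in> F. prod_encode r < prod_encode p}
         else {r \<in> F. prod_encode r < prod_encode p})"
    by auto
  then show ?thesis
    using assms finite_below[of F "prod_encode p"] by (simp add: jw_def)
qed

lemma jw_remove:
  assumes "q \<in> F"
  shows "jw p (F - {q}) = (if prod_encode q < prod_encode p then - jw p F else jw p F)"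
  using jw_insert[of q "F - {q}" p] assms by (auto simp: insert_absorb)

lemma jw_square [simp]: "jw q F * jw q F = 1"
  by (simp add: jw_def flip: power_add mult_2 power_mult)

lemma jw_square' [simp]: "jw q F * (jw q F * x) = x"
  by (simp flip: mult.assoc)

text \<open>Left multiplication by the variable \<open>(a|k)\<close>, read off coefficientwise: the
  coefficient at a monomial comes from the monomial with \<open>(a|k)\<close> taken out, and the
  sign moves \<open>(a|k)\<close> to its place in the increasing product.\<close>

fun cr :: "letter \<Rightarrow> nat \<Rightarrow> fock \<Rightarrow> fock" where
  "cr (Alpha r) k f = (\<lambda>F m. if (r, k) \<in> F then jw (r, k) F * f (F - {(r, k)}) m else 0)"
| "cr (Beta r) k f = (\<lambda>F m. if m (r, k) = 0 then 0 else f F (m((r, k) := m (r, k) - 1)))"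
| "cr (Lt i) k f = (\<lambda>F m. Var i k * f F m)"

text \<open>The left superderivative with respect to \<open>(a|k)\<close>. In the
  \<open>Beta\<close> case the factor is the exponent before it is lowered.\<close>

fun an :: "letter \<Rightarrow> nat \<Rightarrow> fock \<Rightarrow> fock" where
  "an (Alpha r) k f = (\<lambda>F m. if (r, k) \<in> F then 0 else jw (r, k) F * f (insert (r, k) F) m)"
| "an (Beta r) k f = (\<lambda>F m. of_nat (Suc (m (r, k))) * f F (m((r, k) := Suc (m (r, k)))))"
| "an (Lt i) k f = (\<lambda>F m. pd (i, k) (f F m))"

text \<open>A variable \<open>(a|k)\<close> has parity opposite to that of \<open>a\<close>, so only
  two \<open>Alpha\<close> letters give -1. The sign is a constant function, so that it multiplies
  vectors pointwise.\<close>

definition sg :: "letter \<Rightarrow> letter \<Rightarrow> fock" where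
  "sg a b = (if par a = 0 \<and> par b = 0 then - 1 else 1)"

lemma sg_simps [simp]:
  "sg (Alpha r) (Alpha r') = - 1" "sg a (Beta r) = 1" "sg a (Lt r) = 1"
  "sg (Beta r) b = 1" "sg (Lt r) b = 1"
  by (simp_all add: sg_def)

lemma sg_cases: "sg a b = 1 \<or> sg a b = - 1"
  by (simp add: sg_def)

lemma sg_commute: "sg a b = sg b a"
  by (simp add: sg_def conj_commute)

lemma sg_square [simp]: "sg a b * sg a b = 1" "sg a b * (sg a b * f) = f"
  by (simp_all add: sg_def)

lemma additive_cr: "additive (cr a k)"
  by (cases a) (auto simp: additive_def fun_eq_iff distrib_left)

lemma additive_an: "additive (an a k)"
  by (cases a) (auto simp: additive_def fun_eq_iff distrib_left pd_add)

lemmas cr_add = additive.add[OF additive_cr]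
lemmas an_add = additive.add[OF additive_an]
lemmas cr_sum = additive.sum[OF additive_cr]
lemmas an_sum = additive.sum[OF additive_an]
lemmas cr_zero [simp] = additive.zero[OF additive_cr]
lemmas an_zero [simp] = additive.zero[OF additive_an]

lemma additive_sg:
  assumes "additive T"
  shows "T (sg a b * f) = sg a b * T f"
  using additive.minus[OF assms] by (simp add: sg_def)

lemmas cr_sg = additive_sg[OF additive_cr]

lemma Diff_right_commute: "A - B - C = A - C - (B :: 'a set)"
  by auto

lemma pd_jw: "pd v (jw q F * p) = jw q F * pd v p"
  using neg_one_even_power neg_one_odd_power unfolding jw_def
  by (cases "even (card {r \<in> F. prod_encode r < prod_encode q})") (simp_all add: additive.minus[OF additive_pd])

lemma pd_of_nat: "pd v (of_nat c * p) = of_nat c * pd v p"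
  by (induction c) (simp_all add: pd_add distrib_right)

text \<open>Only two \<open>Alpha\<close> variables need an argument: removing the one with the
  smaller code flips the sign of the other, while the converse removal changes nothing, so the two
  orders differ by -1.\<close>

lemma cr_cr: "cr a k (cr b l f) = sg a b * cr b l (cr a k f)"
proof (cases a; cases b)
  fix r r' assume ab: "a = Alpha r" "b = Alpha r'"
  show ?thesis
  proof (intro ext)
    fix F m
    consider "(r, k) = (r', l)" | "prod_encode (r, k) < prod_encode (r', l)"
      | "prod_encode (r', l) < prod_encode (r, k)"
      using inj_prod_encode[of UNIV] by (metis injD linorder_neqE_nat)
    then show "cr a k (cr b l f) F m = (sg a b * cr b l (cr a k f)) F m"
    proof cases
      case 1
      then show ?thesis by (simp add: ab)
    qed (auto simp: ab jw_remove Diff_right_commute mult.left_commute)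
  qed
qed (auto simp: fun_eq_iff fun_upd_twist algebra_simps)

lemma an_an: "an a k (an b l f) = sg a b * an b l (an a k f)"
proof (cases a; cases b)
  fix r r' assume ab: "a = Alpha r" "b = Alpha r'"
  show ?thesis
  proof (intro ext)
    fix F m
    consider "(r, k) = (r', l)" | "prod_encode (r, k) < prod_encode (r', l)"
      | "prod_encode (r', l) < prod_encode (r, k)"
      using inj_prod_encode[of UNIV] by (metis injD linorder_neqE_nat)
    then show "an a k (an b l f) F m = (sg a b * an b l (an a k f)) F m"
    proof cases
      case 1
      then show ?thesis by (simp add: ab)
    qed (auto simp: ab jw_insert insert_commute mult.left_commute)
  qed
qed (auto simp: fun_eq_iff fun_upd_twist algebra_simps pd_commute pd_add pd_jw pd_of_nat)

text \<open>The canonical commutation relations. For one and the same \<open>Alpha\<close> variable,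
  the left side is supported on the sets without that variable and \<open>cr\<close> after
  \<open>an\<close> on the sets containing it, so together they make up \<open>f\<close>.\<close>

lemma an_cr: "an a k (cr b l f) = sg a b * cr b l (an a k f) + (if a = b \<and> k = l then f else 0)"
proof (cases a; cases b)
  fix r r' assume ab: "a = Alpha r" "b = Alpha r'"
  show ?thesis
  proof (intro ext)
    fix F m
    consider "(r, k) = (r', l)" | "prod_encode (r, k) < prod_encode (r', l)"
      | "prod_encode (r', l) < prod_encode (r, k)"
      using inj_prod_encode[of UNIV] by (metis injD linorder_neqE_nat)
    then show "an a k (cr b l f) F m
        = (sg a b * cr b l (an a k f) + (if a = b \<and> k = l then f else 0)) F m"
    proof cases
      case 1
      then show ?thesis by (auto simp: ab jw_insert jw_remove insert_absorb)
    qed (auto simp: ab jw_insert jw_remove insert_Diff_if mult.left_commute)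
  qed
qed (auto simp: fun_eq_iff fun_upd_twist algebra_simps pd_Var_mult pd_add pd_jw pd_of_nat)

section \<open>The action of the general linear Lie superalgebra\<close>

definition Dop :: "nat \<Rightarrow> letter \<Rightarrow> letter \<Rightarrow> fock \<Rightarrow> fock" where
  "Dop n a b f = (\<Sum>k\<in>{1..n}. cr a k (an b k f))"

fun Mop :: "letter \<Rightarrow> letter \<Rightarrow> fock \<Rightarrow> fock" where
  "Mop a (Lt j) f = cr a j f"
| "Mop a _ f = 0"

fun act1 :: "nat \<Rightarrow> gen \<Rightarrow> fock \<Rightarrow> fock" where
  "act1 n (a, b) f = Dop n a b f + Mop a b f"

lemma additive_Dop: "additive (Dop n a b)"
  by (simp add: additive_def Dop_def cr_add an_add sum.distrib)

lemma additive_Mop: "additive (Mop a b)"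
  by (cases b) (simp_all add: additive_def cr_add)

lemma additive_act1: "additive (act1 n g)"
  by (cases g) (simp add: additive_def additive.add[OF additive_Dop] additive.add[OF additive_Mop] algebra_simps)

lemmas Dop_add = additive.add[OF additive_Dop]
lemmas Dop_zero [simp] = additive.zero[OF additive_Dop]
lemmas Dop_sum = additive.sum[OF additive_Dop]

text \<open>The superderivation rule. The sign \<open>sg a c * sg b c\<close> has exponent
  (|a|+|b|)(|c|+1), the parity of the operator times the parity of the variable.\<close>

lemma Dop_cr:
  "Dop n a b (cr c l f) = sg a c * sg b c * cr c l (Dop n a b f) + (if b = c \<and> l \<in> {1..n} then cr a l f else 0)"
proof -
  have "Dop n a b (cr c l f)
      = (\<Sum>k\<in>{1..n}. sg b c * (sg a c * cr c l (cr a k (an b k f))) + (if b = c \<and> k = l then cr a k f else 0))"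
    unfolding Dop_def
    by (intro sum.cong) (auto simp: an_cr cr_add cr_sg cr_cr[of a _ c l])
  also have "\<dots> = sg a c * sg b c * cr c l (Dop n a b f) + (\<Sum>k\<in>{1..n}. if b = c \<and> k = l then cr a k f else 0)"
    unfolding Dop_def by (simp add: sum.distrib cr_sum sum_distrib_left mult_ac)
  also have "(\<Sum>k\<in>{1..n}. if b = c \<and> k = l then cr a k f else 0) = (if b = c \<and> l \<in> {1..n} then cr a l f else 0)"
    by (cases "b = c") (simp_all add: sum.delta)
  finally show ?thesis .
qed

lemma an_Dop:
  "an d l (Dop n a b f) = sg a d * sg b d * Dop n a b (an d l f) + (if a = d \<and> l \<in> {1..n} then an b l f else 0)"
proof -
  have "an d l (Dop n a b f)
      = (\<Sum>k\<in>{1..n}. sg a d * (sg b d * cr a k (an b k (an d l f))) + (if a = d \<and> k = l then an b k f else 0))"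
    unfolding Dop_def an_sum
    by (intro sum.cong) (auto simp: an_cr cr_add cr_sg an_an[of d l b] sg_commute)
  also have "\<dots> = sg a d * sg b d * Dop n a b (an d l f) + (\<Sum>k\<in>{1..n}. if a = d \<and> k = l then an b k f else 0)"
    unfolding Dop_def by (simp add: sum.distrib sum_distrib_left mult_ac)
  also have "(\<Sum>k\<in>{1..n}. if a = d \<and> k = l then an b k f else 0) = (if a = d \<and> l \<in> {1..n} then an b l f else 0)"
    by (cases "a = d") (simp_all add: sum.delta)
  finally show ?thesis .
qed

text \<open>The sign with exponent (|a|+|b|)(|c|+|d|) of the superbracket. Each factor
  \<open>sg a c\<close> has exponent (|a|+1)(|c|+1), and the shifts by 1 cancel modulo 2 in the
  product of the four.\<close>

definition ssg :: "letter \<Rightarrow> letter \<Rightarrow> letter \<Rightarrow> letter \<Rightarrow> fock" where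
  "ssg a b c d = sg a c * sg b c * (sg a d * sg b d)"

text \<open>Both orders reduce to the sum of \<open>cr c l (Dop n a b (an d l f))\<close>: moving
  \<open>Dop n a b\<close> past \<open>cr c l\<close> yields the term with \<open>b = c\<close>,
  moving \<open>an d l\<close> past \<open>Dop n a b\<close> the term with
  \<open>a = d\<close>.\<close>

lemma Dop_Dop:
  "Dop n a b (Dop n c d f) = ssg a b c d * Dop n c d (Dop n a b f)
     + (if b = c then Dop n a d f else 0) - ssg a b c d * (if a = d then Dop n c b f else 0)"
proof -
  have 1: "Dop n a b (Dop n c d f) = sg a c * sg b c * (\<Sum>l\<in>{1..n}. cr c l (Dop n a b (an d l f)))
      + (if b = c then Dop n a d f else 0)"
    unfolding Dop_def[of n c d] Dop_sum Dop_def[of n a d]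
    by (simp add: Dop_cr sum.distrib sum_distrib_left)
  have "Dop n c d (Dop n a b f)
     = (\<Sum>l\<in>{1..n}. sg a d * sg b d * cr c l (Dop n a b (an d l f)) + (if a = d then cr c l (an b l f) else 0))"
    unfolding Dop_def[of n c d]
    by (intro sum.cong) (auto simp: an_Dop cr_add cr_sg mult.assoc)
  also have "\<dots> = sg a d * sg b d * (\<Sum>l\<in>{1..n}. cr c l (Dop n a b (an d l f)))
       + (if a = d then Dop n c b f else 0)"
    by (simp add: sum.distrib sum_distrib_left Dop_def[of n c b])
  finally have 2: "(\<Sum>l\<in>{1..n}. cr c l (Dop n a b (an d l f)))
     = sg a d * sg b d * (Dop n c d (Dop n a b f) - (if a = d then Dop n c b f else 0))"
    by (simp add: algebra_simps)
  show ?thesis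
    unfolding 1 2 by (simp add: ssg_def algebra_simps)
qed

text \<open>For \<open>d = Lt j\<close> the contraction with \<open>(c|j)\<close> occurs only if the
  place \<open>j\<close> lies in the range of summation of \<open>Dop\<close>; this is where
  validity of the letter enters.\<close>

lemma Dop_Mop:
  assumes "valid_letter n d"
  shows "Dop n a b (Mop c d f) = ssg a b c d * Mop c d (Dop n a b f) + (if b = c then Mop a d f else 0)"
  using assms by (cases d) (auto simp: Dop_cr ssg_def)

lemma Mop_Mop: "Mop a b (Mop c d f) = ssg a b c d * Mop c d (Mop a b f)"
  by (cases b; cases d) (simp_all add: ssg_def cr_cr[of a _ c])

lemma ssg_swap: "ssg c d a b = ssg a b c d"
  by (simp add: ssg_def sg_commute mult_ac)

lemma ssg_square [simp]: "ssg a b c d * ssg a b c d = 1" "ssg a b c d * (ssg a b c d * f) = f"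
  using sg_cases[of a c] sg_cases[of b c] sg_cases[of a d] sg_cases[of b d] by (auto simp: ssg_def)

lemma act1_commutator:
  assumes "valid_letter n b" "valid_letter n d"
  shows "act1 n (a, b) (act1 n (c, d) f) = ssg a b c d * act1 n (c, d) (act1 n (a, b) f)
     + (if b = c then act1 n (a, d) f else 0) - ssg a b c d * (if a = d then act1 n (c, b) f else 0)"
proof -
  \<comment> \<open>The rule for \<open>Dop\<close> after \<open>Mop\<close> with the two generators
    exchanged. The sign squares to 1, so it can be solved for the opposite order; this is the source
    of the multiplication term for \<open>a = d\<close>.\<close>
  have 1: "Dop n c d (Mop a b f) = ssg a b c d * Mop a b (Dop n c d f) + (if a = d then Mop c b f else 0)"
    using Dop_Mop[OF assms(1), of c d a f] by (auto simp: ssg_swap)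
  then have 2: "Mop a b (Dop n c d f) = ssg a b c d * (Dop n c d (Mop a b f) - (if a = d then Mop c b f else 0))"
    by (simp add: algebra_simps)
  have 3: "(if P then act1 n (a', b') f else 0) = (if P then Dop n a' b' f else 0) + (if P then Mop a' b' f else 0)" for P a' b'
    by simp
  have "act1 n (a, b) (act1 n (c, d) f)
      = Dop n a b (Dop n c d f) + Dop n a b (Mop c d f) + Mop a b (Dop n c d f) + Mop a b (Mop c d f)"
    by (simp add: Dop_add additive.add[OF additive_Mop])
  also have "\<dots> = ssg a b c d * Dop n c d (Dop n a b f)
     + (if b = c then Dop n a d f else 0) - ssg a b c d * (if a = d then Dop n c b f else 0)
     + (ssg a b c d * Mop c d (Dop n a b f) + (if b = c then Mop a d f else 0))
     + ssg a b c d * (Dop n c d (Mop a b f) - (if a = d then Mop c b f else 0))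
     + ssg a b c d * Mop c d (Mop a b f)"
    by (simp only: Dop_Dop[of n a b c d] Dop_Mop[OF assms(2)] 2 Mop_Mop[of a b c d])
  also have "\<dots> = ssg a b c d * (Dop n c d (Dop n a b f) + Dop n c d (Mop a b f) + (Mop c d (Dop n a b f) + Mop c d (Mop a b f)))
     + ((if b = c then Dop n a d f else 0) + (if b = c then Mop a d f else 0))
     - ssg a b c d * ((if a = d then Dop n c b f else 0) + (if a = d then Mop c b f else 0))"
    by (simp only: distrib_left right_diff_distrib) (simp only: add_ac diff_conv_add_uminus minus_add_distrib)
  also have "Dop n c d (Dop n a b f) + Dop n c d (Mop a b f) + (Mop c d (Dop n a b f) + Mop c d (Mop a b f))
     = act1 n (c, d) (act1 n (a, b) f)"
    by (simp add: Dop_add additive.add[OF additive_Mop])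
  finally show ?thesis
    by (simp only: 3)
qed

lemma ssg_sgn_par: "ssg a b c d = (if sgn_par (a, b) (c, d) = -1 then - 1 else 1)"
  by (cases a; cases b; cases c; cases d) (simp_all add: ssg_def sgn_par_def)

section \<open>The action of words on the vacuum\<close>

definition act :: "nat \<Rightarrow> gen list \<Rightarrow> fock \<Rightarrow> fock" where
  "act n w = foldr (act1 n) w"

lemma act_Nil [simp]: "act n [] f = f"
  and act_Cons [simp]: "act n (g # w) f = act1 n g (act n w f)"
  and act_append [simp]: "act n (u @ w) f = act n u (act n w f)"
  by (simp_all add: act_def)

lemma additive_act: "additive (act n w)"
  by (induction w) (simp_all add: additive_def additive.add[OF additive_act1])

definition vac :: fock where
  "vac = (\<lambda>F m. if F = {} \<and> m = (\<lambda>_. 0) then 1 else 0)"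

text \<open>The component without virtual variables, a polynomial in the \<open>(i|k)\<close>. It
  extends the Koszul map to words containing virtual letters.\<close>

definition vword :: "nat \<Rightarrow> gen list \<Rightarrow> cpoly" where
  "vword n w = act n w vac {} (\<lambda>_. 0)"

lemma vword_relation:
  assumes "valid_word n [(a, b), (c, d)]"
  shows "vword n (u @ [(a, b), (c, d)] @ v) = psc (sgn_par (a, b) (c, d)) (vword n (u @ [(c, d), (a, b)] @ v))
     + (if b = c then vword n (u @ [(a, d)] @ v) else 0)
     - psc (sgn_par (a, b) (c, d)) (if a = d then vword n (u @ [(c, b)] @ v) else 0)"
proof -
  have v: "valid_letter n b" "valid_letter n d"
    using assms by (auto simp: valid_word_def)
  let ?f = "act n v vac"
  \<comment> \<open>Additivity of \<open>act\<close> suffices to pull the sign out, because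
    \<open>ssg\<close> is the constant 1 or -1.\<close>
  have T: "act n u (ssg a b c d * x + (if b = c then y else 0) - ssg a b c d * (if a = d then z else 0))
     = ssg a b c d * act n u x + (if b = c then act n u y else 0) - ssg a b c d * (if a = d then act n u z else 0)" for x y z
    using ssg_sgn_par[of a b c d]
    by (simp add: additive.add[OF additive_act] additive.diff[OF additive_act]
       additive.minus[OF additive_act] additive.zero[OF additive_act])
  have "act n (u @ [(a, b), (c, d)] @ v) vac = act n u (act1 n (a, b) (act1 n (c, d) ?f))"
    by simp
  also have "\<dots> = ssg a b c d * act n (u @ [(c, d), (a, b)] @ v) vac
     + (if b = c then act n (u @ [(a, d)] @ v) vac else 0)
     - ssg a b c d * (if a = d then act n (u @ [(c, b)] @ v) vac else 0)"
    by (simp only: act1_commutator[OF v] T act_append act_Cons act_Nil)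
  finally show ?thesis
    by (auto simp: vword_def ssg_sgn_par sgn_par_def psc_minus_one)
qed

lemma lin_vword_Iid: "x \<in> Iid n \<Longrightarrow> lin (vword n) x = 0"
proof (induction rule: Iid.induct)
  case (gen u v g h)
  obtain a b c d where gh: "g = (a, b)" "h = (c, d)"
    by (metis surj_pair)
  show ?case
    using vword_relation[of n a b c d u v] gen unfolding gh
    by (auto simp: fmul_relator lin_diff lin_fsc psc_zero)
qed (simp_all add: lin_add lin_fsc)

lemma vword_proper:
  assumes "\<forall>(a, b)\<in>set w. \<exists>i j. a = Lt i \<and> b = Lt j"
  shows "vword n w = Kword n w"
proof -
  \<comment> \<open>The induction needs the full vector: proper generators never leave the component
    without virtual variables.\<close>
  have "act n w vac F m = (if F = {} \<and> m = (\<lambda>_. 0) then Kword n w else 0)" for F m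
    using assms
  proof (induction w arbitrary: F m)
    case Nil
    then show ?case by (simp add: vac_def Kword_def)
  next
    case (Cons g w)
    then obtain i j where g: "g = (Lt i, Lt j)" by auto
    have sum_apply: "(\<Sum>k\<in>A. h k) F m = (\<Sum>k\<in>A. h k F m)" for A and h :: "nat \<Rightarrow> fock"
      by (induction A rule: infinite_finite_induct) auto
    show ?case
      using Cons by (simp add: g Dop_def sum_apply Kword_def rho_def Dl_def)
  qed
  then show ?thesis by (simp add: vword_def)
qed

lemma lin_vword_Lspan:
  assumes "x \<in> Lspan n"
  shows "lin (vword n) x = Kmap n x"
  unfolding Kmap_lin lin_def
  by (intro sum.cong refl arg_cong2[where f = psc] vword_proper)
     (use assms in \<open>fastforce simp: Lspan_def\<close>)

section \<open>Irregular words annihilate the vacuum\<close>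

text \<open>The degree in the letter, counted over the places 1 to n only, so that it is finite for
  every \<open>F\<close>. It is an integer so that a vector may formally have negative degree, which
  forces it to be 0. The value for proper letters is a dummy.\<close>

fun vdeg :: "nat \<Rightarrow> letter \<Rightarrow> (nat \<times> nat) set \<Rightarrow> (nat \<times> nat \<Rightarrow> nat) \<Rightarrow> int" where
  "vdeg n (Alpha r) F m = int (card {k\<in>{1..n}. (r, k) \<in> F})"
| "vdeg n (Beta r) F m = (\<Sum>k\<in>{1..n}. int (m (r, k)))"
| "vdeg n (Lt i) F m = 0"

definition homog :: "nat \<Rightarrow> letter \<Rightarrow> int \<Rightarrow> fock \<Rightarrow> bool" where
  "homog n \<gamma> z f = (\<forall>F m. f F m \<noteq> 0 \<longrightarrow> vdeg n \<gamma> F m = z)"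

lemma homog_zero [simp]: "homog n \<gamma> z 0"
  by (simp add: homog_def)

lemma homog_add: "homog n \<gamma> z f \<Longrightarrow> homog n \<gamma> z g \<Longrightarrow> homog n \<gamma> z (f + g)"
  unfolding homog_def by (metis add_0 plus_fun_apply)

lemma homog_sum: "(\<And>k. k \<in> A \<Longrightarrow> homog n \<gamma> z (f k)) \<Longrightarrow> homog n \<gamma> z (\<Sum>k\<in>A. f k)"
  by (induction A rule: infinite_finite_induct) (auto intro: homog_add)

lemma homog_neg:
  assumes "homog n \<gamma> z f" "z < 0"
  shows "f = 0"
proof -
  have "vdeg n \<gamma> F m \<ge> 0" for F m
    by (cases \<gamma>) (auto intro: sum_nonneg)
  then have "f F m = 0" for F m
    using assms unfolding homog_def by (metis not_less)
  then show ?thesis by (simp add: fun_eq_iff)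
qed

lemma vdeg_insert:
  assumes "k \<in> {1..n}" "(r, k) \<notin> F"
  shows "vdeg n \<gamma> (insert (r, k) F) m = vdeg n \<gamma> F m + (if Alpha r = \<gamma> then 1 else 0)"
proof (cases "Alpha r = \<gamma>")
  case True
  have "{k'\<in>{1..n}. (r, k') \<in> insert (r, k) F} = insert k {k'\<in>{1..n}. (r, k') \<in> F}"
    using assms by auto
  then show ?thesis using True[symmetric] assms by simp
next
  case False
  then show ?thesis by (cases \<gamma>) simp_all
qed

lemma vdeg_upd:
  assumes "k \<in> {1..n}"
  shows "vdeg n \<gamma> F (m((r, k) := x)) = vdeg n \<gamma> F m + (if Beta r = \<gamma> then int x - int (m (r, k)) else 0)"
proof (cases "Beta r = \<gamma>")
  case True
  have "(\<Sum>l\<in>{1..n}. int ((m((r, k) := x)) (r, l))) = int x + (\<Sum>l\<in>{1..n} - {k}. int (m (r, l)))"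
    using assms by (subst sum.remove[of _ k]) auto
  moreover have "(\<Sum>l\<in>{1..n}. int (m (r, l))) = int (m (r, k)) + (\<Sum>l\<in>{1..n} - {k}. int (m (r, l)))"
    using assms by (subst sum.remove[of _ k]) auto
  ultimately show ?thesis using True[symmetric] by simp
next
  case False
  then show ?thesis by (cases \<gamma>) simp_all
qed

lemma homog_cr:
  assumes "homog n \<gamma> z f" "k \<in> {1..n}" "virtual \<gamma>"
  shows "homog n \<gamma> (z + (if a = \<gamma> then 1 else 0)) (cr a k f)"
  unfolding homog_def
proof (intro allI impI)
  fix F m assume nz: "cr a k f F m \<noteq> 0"
  show "vdeg n \<gamma> F m = z + (if a = \<gamma> then 1 else 0)"
  proof (cases a)
    case (Alpha r)
    then have rk: "(r, k) \<in> F" and "f (F - {(r, k)}) m \<noteq> 0" using nz by (auto split: if_splits)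
    then have "vdeg n \<gamma> (F - {(r, k)}) m = z" using assms(1) by (simp add: homog_def)
    moreover have "vdeg n \<gamma> F m = vdeg n \<gamma> (F - {(r, k)}) m + (if Alpha r = \<gamma> then 1 else 0)"
      using vdeg_insert[OF assms(2), of r "F - {(r, k)}" \<gamma> m] rk by (simp add: insert_absorb)
    ultimately show ?thesis using Alpha by simp
  next
    case (Beta r)
    then have rk: "m (r, k) \<noteq> 0" and "f F (m((r, k) := m (r, k) - 1)) \<noteq> 0"
      using nz by (auto split: if_splits)
    then have "vdeg n \<gamma> F (m((r, k) := m (r, k) - 1)) = z" using assms(1) unfolding homog_def by blast
    then show ?thesis using Beta rk unfolding vdeg_upd[OF assms(2)]
      by (auto simp: of_nat_diff split: if_splits)
  next
    case (Lt i)
    then have "f F m \<noteq> 0" using nz by auto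
    then show ?thesis using assms Lt by (auto simp: homog_def)
  qed
qed

lemma homog_an:
  assumes "homog n \<gamma> z f" "k \<in> {1..n}" "virtual \<gamma>"
  shows "homog n \<gamma> (z - (if a = \<gamma> then 1 else 0)) (an a k f)"
  unfolding homog_def
proof (intro allI impI)
  fix F m assume nz: "an a k f F m \<noteq> 0"
  show "vdeg n \<gamma> F m = z - (if a = \<gamma> then 1 else 0)"
  proof (cases a)
    case (Alpha r)
    then have rk: "(r, k) \<notin> F" and "f (insert (r, k) F) m \<noteq> 0" using nz by (auto split: if_splits)
    then have "vdeg n \<gamma> (insert (r, k) F) m = z" using assms(1) by (simp add: homog_def)
    then show ?thesis using Alpha unfolding vdeg_insert[OF assms(2) rk] by auto
  next
    case (Beta r)
    then have "f F (m((r, k) := Suc (m (r, k)))) \<noteq> 0" using nz by auto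
    then have "vdeg n \<gamma> F (m((r, k) := Suc (m (r, k)))) = z" using assms(1) unfolding homog_def by blast
    then show ?thesis using Beta unfolding vdeg_upd[OF assms(2)] by (auto split: if_splits)
  next
    case (Lt i)
    then have "f F m \<noteq> 0" using nz by auto
    then show ?thesis using assms Lt by (auto simp: homog_def)
  qed
qed

lemma homog_act1:
  assumes "homog n \<gamma> z f" "virtual \<gamma>" "valid_letter n b"
  shows "homog n \<gamma> (z + (if a = \<gamma> then 1 else 0) - (if b = \<gamma> then 1 else 0)) (act1 n (a, b) f)"
proof -
  have "homog n \<gamma> (z - (if b = \<gamma> then 1 else 0) + (if a = \<gamma> then 1 else 0)) (Dop n a b f)"
    unfolding Dop_def by (intro homog_sum homog_cr homog_an assms) auto
  moreover have "homog n \<gamma> (z - (if b = \<gamma> then 1 else 0) + (if a = \<gamma> then 1 else 0)) (Mop a b f)"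
    using homog_cr[OF assms(1) _ assms(2), of _ a] assms by (cases b) auto
  ultimately show ?thesis
    by (simp add: homog_add algebra_simps)
qed

abbreviation count_fst :: "letter \<Rightarrow> gen list \<Rightarrow> nat" where
  "count_fst \<gamma> w \<equiv> length (filter (\<lambda>g. fst g = \<gamma>) w)"

abbreviation count_snd :: "letter \<Rightarrow> gen list \<Rightarrow> nat" where
  "count_snd \<gamma> w \<equiv> length (filter (\<lambda>g. snd g = \<gamma>) w)"

lemma homog_act_vac:
  assumes "valid_word n w" "virtual \<gamma>"
  shows "homog n \<gamma> (int (count_fst \<gamma> w) - int (count_snd \<gamma> w)) (act n w vac)"
  using assms(1)
proof (induction w)
  case Nil
  then show ?case by (cases \<gamma>) (auto simp: homog_def vac_def)
next
  case (Cons g w)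
  obtain a b where g: "g = (a, b)" by fastforce
  have "homog n \<gamma> (int (count_fst \<gamma> w) - int (count_snd \<gamma> w)) (act n w vac)" "valid_letter n b"
    using Cons g by (auto simp: valid_word_def)
  from homog_act1[OF this(1) assms(2) this(2), of a] show ?case
    by (auto simp: g algebra_simps simp del: act1.simps)
qed

lemma act_irregular_vac:
  assumes "valid_word n w" "irregular w"
  shows "act n w vac = 0"
proof -
  obtain i \<gamma> where i: "1 \<le> i" "i \<le> length w" and \<gamma>: "virtual \<gamma>"
    and less: "count_snd \<gamma> (take i (rev w)) > count_fst \<gamma> (take (i - 1) (rev w))"
    using assms(2) unfolding irregular_def by blast
  \<comment> \<open>Position \<open>i\<close> is counted from the right: \<open>w\<close> splits as
    \<open>p @ g # q\<close>, where \<open>q\<close> consists of the \<open>i - 1\<close> generators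
    acting before \<open>g\<close>.\<close>
  define p where "p = take (length w - i) w"
  obtain g q where gq: "drop (length w - i) w = g # q"
    using i by (cases "drop (length w - i) w") auto
  have w: "w = p @ g # q"
    by (metis append_take_drop_id gq p_def)
  have "length p = length w - i" by (simp add: p_def)
  then have lq: "length q = i - 1" using i w by (metis diff_diff_cancel diff_add_inverse length_append
        length_Cons diff_Suc_1)
  then have tk: "take i (rev w) = rev q @ [g]" "take (i - 1) (rev w) = rev q"
    using i by (auto simp: w)
  have cnt: "count_fst x (rev q) = count_fst x q" "count_snd x (rev q) = count_snd x q" for x
    by (simp_all flip: rev_filter)
  obtain a b where g: "g = (a, b)" by fastforce
  have vq: "valid_word n q" using assms(1) by (auto simp: w valid_word_def)
  note h = homog_act_vac[OF vq \<gamma>]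
  \<comment> \<open>If \<open>g\<close> removes the letter, the excess may be due to
    \<open>g\<close> itself, and the degree turns negative once the annihilation operator is
    applied. Otherwise \<open>q\<close> alone already has too many removals.\<close>
  have "act1 n g (act n q vac) = 0"
  proof (cases "b = \<gamma>")
    case True
    have "homog n \<gamma> (int (count_fst \<gamma> q) - int (count_snd \<gamma> q) - 1) (an b k (act n q vac))"
      if "k \<in> {1..n}" for k
      using homog_an[OF h that \<gamma>, of b] True by simp
    moreover have "int (count_fst \<gamma> q) - int (count_snd \<gamma> q) - 1 < 0"
      using less True unfolding tk by (simp add: g cnt)
    ultimately have "an b k (act n q vac) = 0" if "k \<in> {1..n}" for k
      using homog_neg that by blast
    then have "Dop n a b (act n q vac) = 0" by (simp add: Dop_def)
    moreover have "Mop a b (act n q vac) = 0" using True \<gamma> by (cases b) auto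
    ultimately show ?thesis by (simp add: g)
  next
    case False
    have "act n q vac = 0"
      using less False unfolding tk by (intro homog_neg[OF h]) (simp add: g cnt)
    then show ?thesis by (simp add: additive.zero[OF additive_act1])
  qed
  then show ?thesis
    by (simp add: w additive.zero[OF additive_act])
qed

lemma lin_vword_Irr: "x \<in> Irr n \<Longrightarrow> lin (vword n) x = 0"
proof (induction rule: Irr.induct)
  case (gen u w)
  then show ?case
    by (simp add: vword_def act_irregular_vac additive.zero[OF additive_act])
qed (simp_all add: lin_add lin_fsc lin_vword_Iid)

lemma Kmap_eq_of_represents_proj:
  assumes "represents_proj n x u"
  shows "Kmap n u = lin (vword n) x"
  using assms lin_vword_Irr[of "x - u" n] lin_vword_Lspan[of u n]
  by (simp add: represents_proj_def lin_diff)

section \<open>Evaluation of the virtual words\<close>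

text \<open>Polynomials in the proper variables behave as scalars for every \<open>cr\<close> and
  for the annihilation of virtual letters, but not for derivatives by proper variables.\<close>

definition pm :: "cpoly \<Rightarrow> fock \<Rightarrow> fock" where
  "pm p f = (\<lambda>F m. p * f F m)"

lemma pm_one [simp]: "pm 1 f = f"
  by (simp add: pm_def)

lemma pm_zero_right [simp]: "pm p 0 = 0"
  by (simp add: pm_def fun_eq_iff)

lemma pm_pm [simp]: "pm p (pm q f) = pm (p * q) f"
  by (simp add: pm_def mult.assoc)

lemma additive_pm: "additive (pm p)"
  by (simp add: additive_def pm_def fun_eq_iff distrib_left)

lemmas pm_add = additive.add[OF additive_pm]
lemmas pm_sum = additive.sum[OF additive_pm]

lemma additive_pm_left: "additive (\<lambda>p. pm p f)"
  by (simp add: additive_def pm_def fun_eq_iff distrib_right)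

lemmas pm_sum_left = additive.sum[OF additive_pm_left]

lemma cr_pm: "cr a k (pm p f) = pm p (cr a k f)"
  by (cases a) (auto simp: pm_def fun_eq_iff mult_ac)

lemma an_pm: "virtual a \<Longrightarrow> an a k (pm p f) = pm p (an a k f)"
  by (cases a) (auto simp: pm_def fun_eq_iff mult_ac)

lemma Dop_pm: "virtual b \<Longrightarrow> Dop n a b (pm p f) = pm p (Dop n a b f)"
  by (simp add: Dop_def cr_pm an_pm pm_sum)

text \<open>The sign for exchanging two variables of the same letter: -1 for \<open>Alpha\<close>, 1
  for \<open>Beta\<close>.\<close>

definition eta :: "letter \<Rightarrow> cpoly" where
  "eta a = (if par a = 0 then - 1 else 1)"

lemma eta_square [simp]: "eta a * eta a = 1" "eta a * (eta a * p) = p"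
  by (simp_all add: eta_def)

lemma sg_pm: "par a = par b \<Longrightarrow> sg a b * f = pm (eta a) f"
  by (simp add: sg_def eta_def pm_def fun_eq_iff)

lemma cr_cr_pm: "cr a k (cr a l f) = pm (eta a) (cr a l (cr a k f))"
  using cr_cr[of a k a l f] by (simp add: sg_pm)

lemma Dop_Lt_cr:
  assumes "t \<in> {1..n}"
  shows "Dop n (Lt s) a (cr a t f) = pm (eta a) (cr a t (Dop n (Lt s) a f)) + pm (Var s t) f"
  using assms by (simp add: Dop_cr sg_pm) (simp add: pm_def)

lemma Dop_Lt_cr_other:
  assumes "a \<noteq> b" "par a = par b"
  shows "Dop n (Lt s) a (cr b t f) = pm (eta a) (cr b t (Dop n (Lt s) a f))"
  using assms by (simp add: Dop_cr sg_pm)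

text \<open>The last entry acts first, so this is the product of the variables
  \<open>(a|t 0)\<close>, \<open>(a|t 1)\<close>, and so on, in reading order, applied to
  \<open>f\<close>.\<close>

fun XP :: "letter \<Rightarrow> (nat \<Rightarrow> nat) \<Rightarrow> nat \<Rightarrow> fock \<Rightarrow> fock" where
  "XP a t 0 f = f"
| "XP a t (Suc p) f = XP a t p (cr a (t p) f)"

fun DP :: "nat \<Rightarrow> letter \<Rightarrow> (nat \<Rightarrow> nat) \<Rightarrow> nat \<Rightarrow> fock \<Rightarrow> fock" where
  "DP n a s 0 f = f"
| "DP n a s (Suc p) f = DP n a s p (Dop n (Lt (s p)) a f)"

lemma XP_cong: "(\<And>r. r < p \<Longrightarrow> t r = t' r) \<Longrightarrow> XP a t p f = XP a t' p f"
  by (induction p arbitrary: f) simp_all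

lemma XP_upd: "XP a (t(p := x)) p f = XP a t p f"
  by (rule XP_cong) simp

lemma DP_cong: "(\<And>r. r < p \<Longrightarrow> s r = s' r) \<Longrightarrow> DP n a s p f = DP n a s' p f"
  by (induction p arbitrary: f) simp_all

lemma additive_XP: "additive (XP a t p)"
proof (induction p)
  case (Suc p)
  show ?case
    using additive_comp[OF Suc additive_cr[of a "t p"]] by (simp add: additive_def)
qed (simp add: additive_def)

lemma additive_DP: "additive (DP n a s p)"
proof (induction p)
  case (Suc p)
  show ?case
    using additive_comp[OF Suc additive_Dop[of n "Lt (s p)" a]] by (simp add: additive_def)
qed (simp add: additive_def)

lemmas XP_add = additive.add[OF additive_XP]
lemmas DP_sum = additive.sum[OF additive_DP]

lemma XP_pm: "XP a t p (pm q f) = pm q (XP a t p f)"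
  by (induction p arbitrary: f) (simp_all add: cr_pm)

lemma DP_pm: "virtual a \<Longrightarrow> DP n a s p (pm q f) = pm q (DP n a s p f)"
  by (induction p arbitrary: f) (simp_all add: Dop_pm)

text \<open>A transposition costs one sign whatever the distance: carrying \<open>y\<close> past
  \<open>t P\<close>, exchanging, and carrying \<open>x\<close> back contributes
  \<open>eta a\<close> three times.\<close>

lemma XP_swap:
  assumes "c < P"
  shows "XP a (t(c := x)) P (cr a y f) = pm (eta a) (XP a (t(c := y)) P (cr a x f))"
  using assms
proof (induction P arbitrary: x y f)
  case (Suc P)
  show ?case
  proof (cases "c = P")
    case True
    show ?thesis
      using True by (simp add: cr_cr_pm[of a x y] XP_pm XP_upd fun_upd_same del: fun_upd_apply)
  next
    case False
    then have c: "c < P" using Suc.prems by simp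
    have "XP a (t(c := x)) (Suc P) (cr a y f) = XP a (t(c := x)) P (cr a (t P) (cr a y f))"
      using False by simp
    also have "\<dots> = pm (eta a) (XP a (t(c := x)) P (cr a y (cr a (t P) f)))"
      by (subst cr_cr_pm) (simp add: XP_pm)
    also have "\<dots> = XP a (t(c := y)) P (cr a x (cr a (t P) f))"
      by (simp only: Suc.IH[OF c, of x y] pm_pm eta_square pm_one)
    also have "\<dots> = pm (eta a) (XP a (t(c := y)) P (cr a (t P) (cr a x f)))"
      by (subst cr_cr_pm) (simp add: XP_pm)
    finally show ?thesis
      using False by (simp add: fun_upd_other del: fun_upd_apply)
  qed
qed simp

text \<open>Expansion over the factor that is hit. Instead of deleting the factor in slot
  \<open>c\<close>, the last factor \<open>y\<close> is moved into its slot; reaching slot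
  \<open>c\<close> and filling it together cost a sign that does not depend on
  \<open>c\<close>.\<close>

lemma Dop_XP:
  assumes "virtual a" "\<And>r. r < P \<Longrightarrow> t r \<in> {1..n}" "y \<in> {1..n}"
  shows "Dop n (Lt s) a (XP a t P (cr a y f)) =
      pm (eta a ^ Suc P) (XP a t P (cr a y (Dop n (Lt s) a f)))
    + pm (eta a ^ P * Var s y) (XP a t P f)
    + (\<Sum>c<P. pm (eta a ^ Suc P * Var s (t c)) (XP a (t(c := y)) P f))"
  using assms
proof (induction P arbitrary: y f)
  case 0
  then show ?case by (simp add: Dop_Lt_cr)
next
  case (Suc P)
  let ?e = "eta a"
  have "(\<Sum>c<P. pm (?e ^ Suc P * Var s (t c)) (XP a (t(c := t P)) P (cr a y f)))
      = (\<Sum>c<P. pm (?e ^ Suc (Suc P) * Var s (t c)) (XP a (t(c := y)) P (cr a (t P) f)))"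
    by (intro sum.cong refl) (simp add: XP_swap[of _ P a t "t P" y] mult_ac)
  moreover have "Dop n (Lt s) a (XP a t P (cr a (t P) (cr a y f))) =
      pm (?e ^ Suc P) (XP a t P (cr a (t P) (Dop n (Lt s) a (cr a y f))))
    + pm (?e ^ P * Var s (t P)) (XP a t P (cr a y f))
    + (\<Sum>c<P. pm (?e ^ Suc P * Var s (t c)) (XP a (t(c := t P)) P (cr a y f)))"
    by (rule Suc.IH) (use Suc.prems in auto)
  moreover have "?e ^ P * Var s (t P) = ?e ^ Suc (Suc P) * Var s (t P)"
    by (simp add: mult_ac)
  moreover have "(\<Sum>c<Suc P. pm (?e ^ Suc (Suc P) * Var s (t c)) (XP a (t(c := y)) (Suc P) f))
      = (\<Sum>c<P. pm (?e ^ Suc (Suc P) * Var s (t c)) (XP a (t(c := y)) P (cr a (t P) f)))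
        + pm (?e ^ Suc (Suc P) * Var s (t P)) (XP a t P (cr a y f))"
    unfolding sum.lessThan_Suc XP.simps XP_upd fun_upd_same
    by (intro arg_cong2[where f = "(+)"] sum.cong refl) simp
  ultimately show ?case
    using Suc.prems(3)
    by (simp only: XP.simps) (simp add: Dop_Lt_cr cr_add XP_add pm_add cr_pm XP_pm mult_ac add_ac
        del: fun_upd_apply plus_fun_apply)
qed

definition killed :: "nat \<Rightarrow> letter \<Rightarrow> fock \<Rightarrow> bool" where
  "killed n a f = (\<forall>s. Dop n (Lt s) a f = 0)"

text \<open>The expansion in the shape of \<open>edet_Suc\<close>: below \<open>P\<close>, composing
  with the transposition of \<open>P\<close> and \<open>c\<close> amounts to putting
  \<open>t P\<close> into slot \<open>c\<close>.\<close>

lemma Dop_XP_killed: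
  assumes "virtual a" "killed n a f" "\<And>r. r < Suc P \<Longrightarrow> t r \<in> {1..n}"
  shows "Dop n (Lt s) a (XP a t (Suc P) f) =
    (\<Sum>c\<in>insert P {..<P}. pm (eta a ^ P * (if c = P then 1 else eta a) * Var s (t c)) (XP a (t \<circ> Transposition.transpose P c) P f))"
proof -
  have *: "XP a (t(c := t P)) P f = XP a (t \<circ> Transposition.transpose P c) P f" if "c < P" for c
    using that by (intro XP_cong) (auto simp: Transposition.transpose_def)
  have "Dop n (Lt s) a (XP a t (Suc P) f) = pm (eta a ^ P * Var s (t P)) (XP a t P f)
     + (\<Sum>c<P. pm (eta a ^ Suc P * Var s (t c)) (XP a (t(c := t P)) P f))"
    using assms Dop_XP[of a P t n "t P" s f]
    by (simp add: killed_def additive.zero[OF additive_XP])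
  then show ?thesis
    by (simp add: * mult_ac)
qed

section \<open>Determinants and permanents from one row\<close>

definition esign :: "cpoly \<Rightarrow> (nat \<Rightarrow> nat) \<Rightarrow> cpoly" where
  "esign e \<sigma> = (if evenperm \<sigma> then 1 else e)"

text \<open>The determinant for \<open>e = -1\<close>, the permanent for \<open>e = 1\<close>.\<close>
definition edet :: "cpoly \<Rightarrow> nat \<Rightarrow> (nat \<Rightarrow> nat) \<Rightarrow> (nat \<Rightarrow> nat) \<Rightarrow> cpoly" where
  "edet e p s t = (\<Sum>\<sigma>\<in>{\<sigma>. \<sigma> permutes {..<p}}. esign e \<sigma> * (\<Prod>r<p. Var (s r) (t (\<sigma> r))))"

text \<open>Laplace expansion along row \<open>P\<close>: each permutation is a transposition of
  \<open>P\<close> and \<open>c\<close> after some \<open>q\<close> fixing \<open>P\<close>, hence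
  sends \<open>P\<close> to \<open>c\<close>. The hypothesis makes \<open>esign e\<close>
  multiplicative.\<close>

lemma edet_Suc:
  assumes "e * e = 1"
  shows "edet e (Suc P) s t = (\<Sum>c\<in>insert P {..<P}.
    (if c = P then 1 else e) * Var (s P) (t c) * edet e P s (t \<circ> Transposition.transpose P c))"
proof -
  have "edet e (Suc P) s t = (\<Sum>c\<in>insert P {..<P}. \<Sum>q\<in>{q. q permutes {..<P}}.
      esign e (Transposition.transpose P c \<circ> q)
        * (\<Prod>r<Suc P. Var (s r) (t ((Transposition.transpose P c \<circ> q) r))))"
    unfolding edet_def lessThan_Suc[of P] by (rule sum_over_permutations_insert) auto
  also have "\<dots> = (\<Sum>c\<in>insert P {..<P}. \<Sum>q\<in>{q. q permutes {..<P}}.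
      (if c = P then 1 else e) * Var (s P) (t c)
        * (esign e q * (\<Prod>r<P. Var (s r) ((t \<circ> Transposition.transpose P c) (q r)))))"
  proof (intro sum.cong refl)
    fix c q assume "q \<in> {q. q permutes {..<P}}"
    then have q: "q permutes {..<P}" by simp
    then have "permutation q" by (metis finite_lessThan permutation_permutes)
    then have "evenperm (Transposition.transpose P c \<circ> q) = (evenperm q = (c = P))"
      by (auto simp: evenperm_comp permutation_swap_id evenperm_swap)
    then have "esign e (Transposition.transpose P c \<circ> q) = (if c = P then 1 else e) * esign e q"
      using assms by (auto simp: esign_def)
    moreover have "q P = P" using q by (simp add: permutes_not_in)
    ultimately show "esign e (Transposition.transpose P c \<circ> q)
        * (\<Prod>r<Suc P. Var (s r) (t ((Transposition.transpose P c \<circ> q) r)))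
      = (if c = P then 1 else e) * Var (s P) (t c)
        * (esign e q * (\<Prod>r<P. Var (s r) ((t \<circ> Transposition.transpose P c) (q r))))"
      by (simp add: mult_ac)
  qed
  finally show ?thesis
    by (simp add: edet_def sum_distrib_left)
qed

text \<open>The operator acting on \<open>Suc P\<close> remaining factors contributes
  \<open>eta a ^ P\<close>. These exponents add up to \<open>p choose 2\<close>, which is the origin
  of the sign in the biproduct.\<close>

lemma DP_XP:
  assumes "virtual a" "killed n a f" "\<And>r. r < p \<Longrightarrow> t r \<in> {1..n}"
  shows "DP n a s p (XP a t p f) = pm (eta a ^ (p choose 2) * edet (eta a) p s t) f"
  using assms(3)
proof (induction p arbitrary: t)
  case 0
  have "{\<sigma>. \<sigma> permutes ({} :: nat set)} = {id}" by (simp add: permutes_empty set_eq_iff)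
  then show ?case by (simp add: edet_def esign_def numeral_2_eq_2)
next
  case (Suc P)
  have IH: "DP n a s P (XP a (t \<circ> Transposition.transpose P c) P f)
      = pm (eta a ^ (P choose 2) * edet (eta a) P s (t \<circ> Transposition.transpose P c)) f" if "c \<in> insert P {..<P}" for c
    by (rule Suc.IH) (use that Suc.prems in \<open>auto simp: Transposition.transpose_def\<close>)
  have "Dop n (Lt (s P)) a (XP a t (Suc P) f) =
    (\<Sum>c\<in>insert P {..<P}. pm (eta a ^ P * (if c = P then 1 else eta a) * Var (s P) (t c)) (XP a (t \<circ> Transposition.transpose P c) P f))"
    by (rule Dop_XP_killed[OF assms(1,2)]) (use Suc.prems in blast)
  then have "DP n a s (Suc P) (XP a t (Suc P) f) = (\<Sum>c\<in>insert P {..<P}.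
      pm (eta a ^ P * (if c = P then 1 else eta a) * Var (s P) (t c))
        (DP n a s P (XP a (t \<circ> Transposition.transpose P c) P f)))"
    by (simp only: DP.simps DP_sum DP_pm[OF assms(1)])
  also have "\<dots> = (\<Sum>c\<in>insert P {..<P}.
      pm (eta a ^ P * (if c = P then 1 else eta a) * Var (s P) (t c))
        (pm (eta a ^ (P choose 2) * edet (eta a) P s (t \<circ> Transposition.transpose P c)) f))"
    by (intro sum.cong refl) (simp only: IH)
  also have "\<dots> = pm (eta a ^ P * eta a ^ (P choose 2) * edet (eta a) (Suc P) s t) f"
    unfolding pm_pm pm_sum_left[symmetric]
    by (simp only: edet_Suc[OF eta_square(1)] sum_distrib_left mult_ac)
  also have "eta a ^ P * eta a ^ (P choose 2) = eta a ^ (Suc P choose 2)"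
    by (simp add: numeral_2_eq_2 power_add)
  finally show ?case .
qed

section \<open>Several rows with distinct virtual letters\<close>

lemma Dop_XP_other:
  assumes "virtual a" "a \<noteq> b" "par a = par b"
  shows "Dop n (Lt s) a (XP b t p f) = pm (eta a ^ p) (XP b t p (Dop n (Lt s) a f))"
  by (induction p arbitrary: f) (simp_all add: Dop_Lt_cr_other[OF assms(2,3)] XP_pm mult_ac)

text \<open>With distinct letters there is no contraction; each of the \<open>q\<close> operators
  merely passes \<open>p\<close> variables. This produces the sign between rows of a
  bitableau.\<close>

lemma DP_XP_other:
  assumes "virtual a" "a \<noteq> b" "par a = par b"
  shows "DP n a s q (XP b t p f) = pm (eta a ^ (q * p)) (XP b t p (DP n a s q f))"
  by (induction q arbitrary: f) (simp_all add: Dop_XP_other[OF assms] DP_pm[OF assms(1)] power_add)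

fun XR :: "(nat \<Rightarrow> letter) \<Rightarrow> nat list list \<Rightarrow> nat \<Rightarrow> fock \<Rightarrow> fock" where
  "XR v T 0 f = f"
| "XR v T (Suc m) f = XR v T m (XP (v (Suc m)) ((!) (T ! m)) (length (T ! m)) f)"

fun DR :: "nat \<Rightarrow> (nat \<Rightarrow> letter) \<Rightarrow> nat list list \<Rightarrow> nat \<Rightarrow> fock \<Rightarrow> fock" where
  "DR n v S 0 f = f"
| "DR n v S (Suc m) f = DR n v S m (DP n (v (Suc m)) ((!) (S ! m)) (length (S ! m)) f)"

lemma DP_XR:
  assumes "virtual a" "\<And>l. l < m \<Longrightarrow> a \<noteq> v (Suc l) \<and> par a = par (v (Suc l))"
  shows "DP n a s q (XR v T m f) = pm (eta a ^ (q * (\<Sum>l<m. length (T ! l)))) (XR v T m (DP n a s q f))"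
  using assms(2)
proof (induction m arbitrary: f)
  case (Suc m)
  have XR_pm: "XR v T m (pm p g) = pm p (XR v T m g)" for p g
    by (induction m arbitrary: g) (simp_all add: XP_pm)
  have "DP n a s q (XP (v (Suc m)) ((!) (T ! m)) (length (T ! m)) f) =
      pm (eta a ^ (q * length (T ! m))) (XP (v (Suc m)) ((!) (T ! m)) (length (T ! m)) (DP n a s q f))"
    using Suc.prems[of m] by (intro DP_XP_other[OF assms(1)]) auto
  then show ?case
    using Suc by (simp add: XR_pm power_add distrib_left mult_ac)
qed simp

text \<open>Handles both choices at once, with \<open>e = - 1\<close> for \<open>Alpha\<close> and
  \<open>e = 1\<close> for \<open>Beta\<close>. Injectivity keeps different rows from contracting
  with each other.\<close>

locale virtual_alphabet =
  fixes v :: "nat \<Rightarrow> letter" and e :: cpoly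
  assumes virt: "virtual (v r)" and inj_v: "inj v" and eta_v: "eta (v r) = e"
    and par_v: "par (v r) = par (v r')"
begin

lemma DR_pm: "DR n v S m (pm p f) = pm p (DR n v S m f)"
  by (induction m arbitrary: f) (simp_all add: DP_pm virt)

text \<open>The operators of the last row act first: they pass the variables of all earlier rows,
  then turn their own row into a polynomial factor, which is a scalar for the remaining
  rows.\<close>

lemma DR_XR:
  assumes "\<And>r. killed n (v r) f"
    and "\<And>r. r < m \<Longrightarrow> length (S ! r) = length (T ! r) \<and> set (T ! r) \<subseteq> {1..n}"
  shows "DR n v S m (XR v T m f)
    = pm (e ^ (\<Sum>k<m. length (S ! k) * (\<Sum>l<k. length (T ! l)))
        * (\<Prod>r<m. e ^ (length (S ! r) choose 2) * edet e (length (S ! r)) ((!) (S ! r)) ((!) (T ! r)))) f"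
  using assms
proof (induction m arbitrary: f)
  case (Suc m)
  let ?row = "e ^ (length (S ! m) choose 2) * edet e (length (S ! m)) ((!) (S ! m)) ((!) (T ! m))"
  have row: "DP n (v (Suc m)) ((!) (S ! m)) (length (S ! m)) (XP (v (Suc m)) ((!) (T ! m)) (length (T ! m)) f) = pm ?row f"
    using Suc.prems(2)[of m] nth_mem
    by (subst DP_XP[OF virt Suc.prems(1), symmetric, unfolded eta_v]) (auto simp: subset_iff)
  have "killed n (v r) (pm ?row f)" for r
    using Suc.prems(1)[of r] by (simp add: killed_def Dop_pm virt)
  then have IH: "DR n v S m (XR v T m (pm ?row f))
    = pm (e ^ (\<Sum>k<m. length (S ! k) * (\<Sum>l<k. length (T ! l)))
        * (\<Prod>r<m. e ^ (length (S ! r) choose 2) * edet e (length (S ! r)) ((!) (S ! r)) ((!) (T ! r)))) (pm ?row f)"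
    using Suc.prems by (intro Suc.IH) auto
  have "DP n (v (Suc m)) s q (XR v T m g) = pm (e ^ (q * (\<Sum>l<m. length (T ! l)))) (XR v T m (DP n (v (Suc m)) s q g))" for s q g
    by (subst DP_XR) (auto simp: virt eta_v dest: injD[OF inj_v] intro: par_v)
  then show ?case
    by (simp add: DR_pm row IH power_add mult_ac)
qed simp

section \<open>Virtual words applied to the vacuum\<close>

definition no_Lt :: "fock \<Rightarrow> bool" where
  "no_Lt f = (\<forall>j k. an (Lt j) k f = 0)"

lemma no_Lt_cr: "no_Lt f \<Longrightarrow> no_Lt (cr (v r) k f)"
  using virt[of r] by (cases "v r") (auto simp: no_Lt_def an_cr simp del: an.simps cr.simps)

text \<open>As long as only virtual variables have been created, there is no proper letter to
  polarize, so the generator acts by pure multiplication.\<close>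

lemma act1_v_Lt: "no_Lt f \<Longrightarrow> act1 n (v r, Lt t) f = cr (v r) t f"
  by (simp add: no_Lt_def Dop_def)

lemma no_Lt_XP: "no_Lt f \<Longrightarrow> no_Lt (XP (v r) t p f)"
  by (induction p arbitrary: f) (simp_all add: no_Lt_cr)

lemma act_row_XP:
  "no_Lt f \<Longrightarrow> act n (map (\<lambda>t. (v r, Lt t)) \<pi>) f = XP (v r) ((!) \<pi>) (length \<pi>) f"
proof (induction \<pi> arbitrary: f rule: rev_induct)
  case (snoc x \<pi>)
  have "XP (v r) ((!) (\<pi> @ [x])) (length \<pi>) g = XP (v r) ((!) \<pi>) (length \<pi>) g" for g
    by (rule XP_cong) (simp add: nth_append)
  then show ?case
    using snoc.IH[OF no_Lt_cr[OF snoc.prems]] act1_v_Lt[OF snoc.prems] by (simp del: act1.simps)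
qed simp

lemma act_row_DP: "act n (map (\<lambda>s. (Lt s, v r)) \<omega>) f = DP n (v r) ((!) \<omega>) (length \<omega>) f"
proof (induction \<omega> arbitrary: f rule: rev_induct)
  case (snoc x \<omega>)
  have "DP n (v r) ((!) (\<omega> @ [x])) (length \<omega>) g = DP n (v r) ((!) \<omega>) (length \<omega>) g" for g
    by (rule DP_cong) (simp add: nth_append)
  moreover have "Mop (Lt x) (v r) f = 0"
    using virt[of r] by (cases "v r") auto
  ultimately show ?case
    using snoc.IH by simp
qed simp

lemma act_rows_XR:
  "no_Lt f \<Longrightarrow> act n (concat (map (\<lambda>r. map (\<lambda>t. (v (Suc r), Lt t)) (T ! r)) [0..<m])) f = XR v T m f"
  by (induction m arbitrary: f) (simp_all add: act_row_XP no_Lt_XP)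

lemma act_rows_DR:
  "act n (concat (map (\<lambda>r. map (\<lambda>s. (Lt s, v (Suc r))) (S ! r)) [0..<m])) f = DR n v S m f"
  by (induction m arbitrary: f) (simp_all add: act_row_DP)

lemma vword_virt_word:
  assumes "length S = length T"
    and "\<And>r. r < length S \<Longrightarrow> length (S ! r) = length (T ! r) \<and> set (T ! r) \<subseteq> {1..n}"
  shows "vword n (virt_word v S T)
    = e ^ (\<Sum>k<length S. length (S ! k) * (\<Sum>l<k. length (T ! l)))
        * (\<Prod>r<length S. e ^ (length (S ! r) choose 2) * edet e (length (S ! r)) ((!) (S ! r)) ((!) (T ! r)))"
proof -
  have vac: "no_Lt vac"
    by (auto simp: no_Lt_def vac_def fun_eq_iff)
  have "an (v r) k vac = 0" for r k
    using virt[of r] by (cases "v r") (auto simp: vac_def fun_eq_iff)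
  then have killed: "killed n (v r) vac" for r
    by (simp add: killed_def Dop_def)
  have "act n (virt_word v S T) vac = DR n v S (length S) (XR v T (length S) vac)"
    unfolding virt_word_def act_append assms(1) by (simp only: act_rows_XR[OF vac] act_rows_DR)
  also have "\<dots> = pm (e ^ (\<Sum>k<length S. length (S ! k) * (\<Sum>l<k. length (T ! l)))
        * (\<Prod>r<length S. e ^ (length (S ! r) choose 2) * edet e (length (S ! r)) ((!) (S ! r)) ((!) (T ! r)))) vac"
    by (rule DR_XR[OF killed assms(2)])
  finally show ?thesis
    unfolding vword_def by (simp only: pm_def vac_def simp_thms if_True mult_1_right)
qed

end

interpretation Alpha: virtual_alphabet Alpha "- 1"
proof
  show "inj Alpha" by (rule injI) simp
qed (simp_all add: eta_def)

interpretation Beta: virtual_alphabet Beta 1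
proof
  show "inj Beta" by (rule injI) simp
qed (simp_all add: eta_def)

lemma det_var_edet: "det_var \<omega> \<pi> = edet (- 1) (length \<omega>) ((!) \<omega>) ((!) \<pi>)"
  unfolding det_var_def edet_def by (intro sum.cong refl) (simp add: esign_def sign_def)

lemma per_var_edet: "per_var \<omega> \<pi> = edet 1 (length \<omega>) ((!) \<omega>) ((!) \<pi>)"
  unfolding per_var_def edet_def by (intro sum.cong refl) (simp add: esign_def)

lemma tableau_shape:
  assumes "tableau_on n T" "map length S = map length T"
  shows "length S = length T"
    and "\<And>r. r < length S \<Longrightarrow> length (S ! r) = length (T ! r) \<and> set (T ! r) \<subseteq> {1..n}"
proof -
  show l: "length S = length T" using map_eq_imp_length_eq[OF assms(2)] .
  fix r assume r: "r < length S"
  have "length (S ! r) = map length S ! r" using r by simp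
  also have "\<dots> = length (T ! r)" unfolding assms(2) using r l by simp
  finally have "length (S ! r) = length (T ! r)" .
  moreover have "T ! r \<in> set T" using r l by simp
  ultimately show "length (S ! r) = length (T ! r) \<and> set (T ! r) \<subseteq> {1..n}"
    using assms(1) unfolding tableau_on_def by blast
qed

lemma vword_Alpha:
  assumes "tableau_on n T" "map length S = map length T"
  shows "vword n (virt_word Alpha S T) = bitab S T"
  unfolding bitab_def biprod_def det_var_edet
  by (rule Alpha.vword_virt_word) (simp_all only: tableau_shape[OF assms])

lemma vword_Beta:
  assumes "tableau_on n T" "map length S = map length T"
  shows "vword n (virt_word Beta S T) = bitab_star S T"
proof -
  have "vword n (virt_word Beta S T)
    = 1 ^ (\<Sum>k<length S. length (S ! k) * (\<Sum>l<k. length (T ! l)))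
        * (\<Prod>r<length S. 1 ^ (length (S ! r) choose 2) * edet 1 (length (S ! r)) ((!) (S ! r)) ((!) (T ! r)))"
    by (rule Beta.vword_virt_word) (simp_all only: tableau_shape[OF assms])
  then show ?thesis
    by (simp add: bitab_star_def per_var_edet)
qed

section \<open>The Koszul map is bijective\<close>

definition supp :: "'a set \<Rightarrow> ('a \<Rightarrow>\<^sub>0 'b::zero) set" where
  "supp M = {p. Poly_Mapping.keys p \<subseteq> M}"

lemma suppI: "(\<And>m. m \<in> Poly_Mapping.keys p \<Longrightarrow> m \<in> M) \<Longrightarrow> p \<in> supp M"
  by (auto simp: supp_def)

lemma suppD: "p \<in> supp M \<Longrightarrow> m \<in> Poly_Mapping.keys p \<Longrightarrow> m \<in> M"
  by (auto simp: supp_def)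

lemma supp_mono: "M \<subseteq> M' \<Longrightarrow> supp M \<subseteq> supp M'"
  by (auto simp: supp_def)

lemma supp_zero [simp]: "0 \<in> supp M"
  by (simp add: supp_def)

lemma supp_add: "p \<in> supp M \<Longrightarrow> q \<in> supp M \<Longrightarrow> p + q \<in> supp M"
  using Poly_Mapping.keys_add[of p q] by (auto simp: supp_def)

lemma supp_diff:
  fixes p q :: "'a \<Rightarrow>\<^sub>0 'b::ab_group_add"
  shows "p \<in> supp M \<Longrightarrow> q \<in> supp M \<Longrightarrow> p - q \<in> supp M"
  by (rule suppI) (metis add_0 diff_0_right in_keys_iff lookup_minus suppD)

lemma supp_sum: "(\<And>i. i \<in> A \<Longrightarrow> f i \<in> supp M) \<Longrightarrow> (\<Sum>i\<in>A. f i) \<in> supp M"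
  by (induction A rule: infinite_finite_induct) (auto intro: supp_add)

lemma supp_single: "m \<in> M \<Longrightarrow> Poly_Mapping.single m c \<in> supp M"
  by (simp add: supp_def)

lemma supp_psc: "p \<in> supp M \<Longrightarrow> psc c p \<in> supp M"
  by (rule suppI) (metis in_keys_iff lookup_psc mult_zero_right suppD)

lemma supp_fsc: "x \<in> supp M \<Longrightarrow> fsc c x \<in> supp M"
  by (rule suppI) (metis in_keys_iff lookup_fsc mult_zero_right suppD)

lemma supp_wd: "w \<in> M \<Longrightarrow> wd w \<in> supp M"
  by (simp add: wd_def supp_single)

lemma supp_lin: "(\<And>w. w \<in> Poly_Mapping.keys x \<Longrightarrow> \<phi> w \<in> supp M) \<Longrightarrow> lin \<phi> x \<in> supp M"
  unfolding lin_def by (intro supp_sum supp_psc)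

lemma supp_Var_mult:
  assumes "p \<in> supp M" "\<And>m. m \<in> M \<Longrightarrow> Poly_Mapping.single (i, j) 1 + m \<in> M'"
  shows "Var i j * p \<in> supp M'"
proof (rule suppI)
  fix k assume "k \<in> Poly_Mapping.keys (Var i j * p)"
  then obtain m where "m \<in> Poly_Mapping.keys p" "k = Poly_Mapping.single (i, j) 1 + m"
    using keys_mult[of "Var i j" p] unfolding Var_def keys_single by fastforce
  then show "k \<in> M'" using assms(2)[OF suppD[OF assms(1)]] by simp
qed

lemma supp_pd:
  assumes "p \<in> supp M"
    and "\<And>m. m \<in> M \<Longrightarrow> Poly_Mapping.lookup m v \<noteq> 0 \<Longrightarrow> m - Poly_Mapping.single v 1 \<in> M'"
  shows "pd v p \<in> supp M'"
  unfolding pd_def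
proof (rule supp_sum)
  fix m assume "m \<in> Poly_Mapping.keys p"
  then have m: "m \<in> M" by (rule suppD[OF assms(1)])
  show "Poly_Mapping.single (m - Poly_Mapping.single v 1)
      (of_nat (Poly_Mapping.lookup m v) * Poly_Mapping.lookup p m) \<in> supp M'"
  proof (cases "Poly_Mapping.lookup m v = 0")
    case False
    then show ?thesis using m by (intro supp_single assms(2))
  qed simp
qed

section \<open>The degree filtration on polynomials\<close>

definition mdeg :: "('a \<Rightarrow>\<^sub>0 nat) \<Rightarrow> nat" where
  "mdeg m = (\<Sum>v\<in>Poly_Mapping.keys m. Poly_Mapping.lookup m v)"

lemma mdeg_zero [simp]: "mdeg 0 = 0"
  by (simp add: mdeg_def)

lemma mdeg_single_add [simp]: "mdeg (Poly_Mapping.single v (Suc 0) + m) = Suc (mdeg m)"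
proof -
  have "mdeg q = (\<Sum>u\<in>insert v (Poly_Mapping.keys m). Poly_Mapping.lookup q u)"
    if "Poly_Mapping.keys q \<subseteq> insert v (Poly_Mapping.keys m)" for q
    unfolding mdeg_def using that by (intro sum.mono_neutral_left) (auto simp: in_keys_iff)
  then have "mdeg m = (\<Sum>u\<in>insert v (Poly_Mapping.keys m). Poly_Mapping.lookup m u)"
    and "mdeg (Poly_Mapping.single v (Suc 0) + m)
      = (\<Sum>u\<in>insert v (Poly_Mapping.keys m). Poly_Mapping.lookup (Poly_Mapping.single v (Suc 0) + m) u)"
    using Poly_Mapping.keys_add[of "Poly_Mapping.single v (Suc 0)" m] by auto
  then show ?thesis
    by (simp only:) (simp add: lookup_add lookup_single sum.distrib when_def sum.delta)
qed

lemma single_add_diff_single: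
  assumes "Poly_Mapping.lookup m v \<noteq> (0::nat)"
  shows "Poly_Mapping.single v (Suc 0) + (m - Poly_Mapping.single v (Suc 0)) = m"
  by (rule poly_mapping_eqI) (use assms in \<open>auto simp: lookup_add lookup_minus lookup_single when_def\<close>)

text \<open>The bound is strict, so that \<open>d = 0\<close> admits only the zero polynomial, which
  starts the inductions on \<open>d\<close>.\<close>

definition monomials :: "nat \<Rightarrow> nat \<Rightarrow> ((nat \<times> nat) \<Rightarrow>\<^sub>0 nat) set" where
  "monomials n d = {m. Poly_Mapping.keys m \<subseteq> {1..n} \<times> {1..n} \<and> mdeg m < d}"

lemma Cpoly_supp: "Cpoly n = supp {m. Poly_Mapping.keys m \<subseteq> {1..n} \<times> {1..n}}"
  by (fastforce simp: Cpoly_def supp_def)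

lemma monomials_mono: "d \<le> d' \<Longrightarrow> monomials n d \<subseteq> monomials n d'"
  by (auto simp: monomials_def)

lemma supp_monomials_Cpoly: "p \<in> supp (monomials n d) \<Longrightarrow> p \<in> Cpoly n"
  by (auto simp: Cpoly_supp supp_def monomials_def)

lemma monomials_single_add:
  assumes "m \<in> monomials n d" "i \<in> {1..n}" "j \<in> {1..n}"
  shows "Poly_Mapping.single (i, j) (Suc 0) + m \<in> monomials n (Suc d)"
  using assms Poly_Mapping.keys_add[of "Poly_Mapping.single (i, j) (Suc 0)" m]
  by (auto simp: monomials_def)

lemma monomials_diff_single:
  assumes "m \<in> monomials n (Suc d)" "Poly_Mapping.lookup m v \<noteq> 0"
  shows "m - Poly_Mapping.single v (Suc 0) \<in> monomials n d"
proof -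
  have "mdeg m = Suc (mdeg (m - Poly_Mapping.single v (Suc 0)))"
    using mdeg_single_add[of v "m - Poly_Mapping.single v (Suc 0)"] single_add_diff_single[OF assms(2)] by simp
  moreover have "Poly_Mapping.keys (m - Poly_Mapping.single v (Suc 0)) \<subseteq> Poly_Mapping.keys m"
    by (auto simp: in_keys_iff lookup_minus)
  ultimately show ?thesis
    using assms(1) by (auto simp: monomials_def)
qed

text \<open>A derivation \<open>Dl\<close> trades one variable for another and so preserves the
  filtration; only the multiplication part of \<open>rho\<close> raises the degree.\<close>

lemma Dl_supp:
  assumes "p \<in> supp (monomials n d)" "i \<in> {1..n}"
  shows "Dl n i j p \<in> supp (monomials n d)"
proof (cases d)
  case 0
  then have "p = 0" using assms(1) by (auto simp: supp_def monomials_def)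
  then show ?thesis by (simp add: Dl_def)
next
  case (Suc d')
  show ?thesis
    unfolding Dl_def
  proof (rule supp_sum)
    fix k assume k: "k \<in> {1..n}"
    have "pd (j, k) p \<in> supp (monomials n d')"
      using assms(1) by (rule supp_pd) (simp add: Suc monomials_diff_single)
    then show "Var i k * pd (j, k) p \<in> supp (monomials n d)"
      by (rule supp_Var_mult) (use k assms(2) in \<open>simp add: Suc monomials_single_add\<close>)
  qed
qed

section \<open>Words, their monomials and leading terms\<close>

definition proper :: "nat \<Rightarrow> gen list \<Rightarrow> bool" where
  "proper n w = (\<forall>(a, b)\<in>set w. \<exists>i j. a = Lt i \<and> b = Lt j \<and> 1 \<le> i \<and> i \<le> n \<and> 1 \<le> j \<and> j \<le> n)"

lemma Lspan_supp: "Lspan n = supp {w. proper n w}"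
  by (auto simp: Lspan_def supp_def proper_def)

lemma proper_Nil [simp]: "proper n []"
  and proper_append [simp]: "proper n (u @ w) \<longleftrightarrow> proper n u \<and> proper n w"
  by (simp_all add: proper_def ball_Un)

lemma proper_Cons: "proper n (g # w) \<longleftrightarrow>
    (\<exists>i j. g = (Lt i, Lt j) \<and> i \<in> {1..n} \<and> j \<in> {1..n}) \<and> proper n w"
  by (auto simp: proper_def)

lemma proper_valid: "proper n w \<Longrightarrow> valid_word n w"
  by (fastforce simp: proper_def valid_word_def)

fun word_monomial :: "gen list \<Rightarrow> (nat \<times> nat) \<Rightarrow>\<^sub>0 nat" where
  "word_monomial ((Lt i, Lt j) # w) = Poly_Mapping.single (i, j) 1 + word_monomial w"
| "word_monomial _ = 0"

lemma word_monomial_mem: "proper n w \<Longrightarrow> word_monomial w \<in> monomials n (Suc (length w))"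
  by (induction w) (auto simp: proper_Cons monomials_single_add, simp add: monomials_def)

lemma mdeg_word_monomial: "proper n w \<Longrightarrow> mdeg (word_monomial w) = length w"
  by (induction w) (auto simp: proper_Cons)

lemma lookup_word_monomial:
  "proper n w \<Longrightarrow> Poly_Mapping.lookup (word_monomial w) (i, j) = count (mset w) (Lt i, Lt j)"
  by (induction w) (auto simp: proper_Cons lookup_add lookup_single when_def split: if_splits)

lemma mset_eq_of_word_monomial_eq:
  assumes "proper n w" "proper n w'" "word_monomial w = word_monomial w'"
  shows "mset w = mset w'"
proof (rule multiset_eqI)
  fix g :: gen
  show "count (mset w) g = count (mset w') g"
  proof (cases "\<exists>i j. g = (Lt i, Lt j)")
    case True
    then show ?thesis using assms lookup_word_monomial by metis
  next
    case False
    then have "g \<notin> set w" "g \<notin> set w'"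
      using assms(1,2) by (auto simp: proper_def)
    then show ?thesis by (metis count_mset_0_iff)
  qed
qed

lemma ex_word_monomial:
  assumes "Poly_Mapping.keys m \<subseteq> {1..n} \<times> {1..n}"
  shows "\<exists>w. proper n w \<and> word_monomial w = m"
  using assms
proof (induction "mdeg m" arbitrary: m)
  case 0
  then have "m = 0"
    by (intro poly_mapping_eqI) (auto simp: mdeg_def in_keys_iff)
  then show ?case by (intro exI[of _ "[]"]) simp
next
  case (Suc d)
  then have "Poly_Mapping.keys m \<noteq> {}" by (auto simp: mdeg_def)
  then obtain i j where ij: "(i, j) \<in> Poly_Mapping.keys m" by fast
  let ?m = "m - Poly_Mapping.single (i, j) (Suc 0)"
  have m: "Poly_Mapping.single (i, j) (Suc 0) + ?m = m"
    using ij by (intro single_add_diff_single) (simp add: in_keys_iff)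
  have "Poly_Mapping.keys ?m \<subseteq> Poly_Mapping.keys m"
    by (auto simp: in_keys_iff lookup_minus)
  moreover have "d = mdeg ?m"
    using mdeg_single_add[of "(i, j)" ?m] Suc.hyps(2) by (simp add: m)
  ultimately obtain w where "proper n w" "word_monomial w = ?m"
    using Suc.hyps(1)[of ?m] Suc.prems by blast
  then show ?case
    using ij m Suc.prems by (intro exI[of _ "(Lt i, Lt j) # w"]) (auto simp: proper_Cons)
qed

text \<open>Multiplying the leading monomial by \<open>(i|j)\<close> gives the new one. The
  derivation term and the product of \<open>(i|j)\<close> with the old remainder both have degree at
  most the old length.\<close>

lemma Kword_leading_term:
  "proper n w \<Longrightarrow> Kword n w - Poly_Mapping.single (word_monomial w) 1 \<in> supp (monomials n (length w))"
proof (induction w)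
  case Nil
  then show ?case by (simp add: Kword_def)
next
  case (Cons g w)
  then obtain i j where g: "g = (Lt i, Lt j)" "i \<in> {1..n}" "j \<in> {1..n}" and w: "proper n w"
    by (auto simp: proper_Cons)
  let ?s = "Poly_Mapping.single (word_monomial w) 1 :: cpoly"
  define r where "r = Kword n w - ?s"
  have r: "r \<in> supp (monomials n (length w))" using Cons.IH[OF w] by (simp add: r_def)
  have K: "Kword n w = r + ?s" by (simp add: r_def)
  have "r + ?s \<in> supp (monomials n (Suc (length w)))"
    using r supp_mono[OF monomials_mono, of "length w" "Suc (length w)" n] word_monomial_mem[OF w]
    by (auto intro!: supp_add supp_single)
  then have 1: "Dl n i j (r + ?s) \<in> supp (monomials n (Suc (length w)))"
    using g by (intro Dl_supp)
  have 2: "Var i j * r \<in> supp (monomials n (Suc (length w)))"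
    using r by (rule supp_Var_mult) (use g in \<open>simp add: monomials_single_add\<close>)
  have "Kword n (g # w) = Dl n i j (r + ?s) + Var i j * r + Var i j * ?s"
    by (simp add: Kword_def g rho_def K[unfolded Kword_def] distrib_left)
  also have "Var i j * ?s = Poly_Mapping.single (word_monomial (g # w)) 1"
    by (simp add: Var_def mult_single g)
  finally show ?case
    using supp_add[OF 1 2] by simp
qed

lemma Kword_Cpoly:
  assumes "proper n w"
  shows "Kword n w \<in> Cpoly n"
proof -
  have "Kword n w - Poly_Mapping.single (word_monomial w) 1 \<in> supp (monomials n (Suc (length w)))"
    using Kword_leading_term[OF assms] by (rule subsetD[OF supp_mono[OF monomials_mono], rotated]) simp
  then have "Kword n w - Poly_Mapping.single (word_monomial w) 1 + Poly_Mapping.single (word_monomial w) 1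
      \<in> supp (monomials n (Suc (length w)))"
    by (intro supp_add supp_single word_monomial_mem assms)
  then show ?thesis
    by (intro supp_monomials_Cpoly[of _ n "Suc (length w)"]) simp
qed

section \<open>The image of the Koszul map\<close>

lemma Kmap_Cpoly:
  assumes "x \<in> Lspan n"
  shows "Kmap n x \<in> Cpoly n"
  unfolding Kmap_lin Cpoly_supp
proof (rule supp_lin, fold Cpoly_supp)
  fix w assume "w \<in> Poly_Mapping.keys x"
  then have "proper n w" using suppD[OF assms[unfolded Lspan_supp]] by simp
  then show "Kword n w \<in> Cpoly n" by (rule Kword_Cpoly)
qed

lemma Kmap_add: "Kmap n (x + y) = Kmap n x + Kmap n y"
  and Kmap_diff: "Kmap n (x - y) = Kmap n x - Kmap n y"
  and Kmap_fsc: "Kmap n (fsc c x) = psc c (Kmap n x)"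
  and Kmap_wd: "Kmap n (wd w) = Kword n w"
  and Kmap_sum: "Kmap n (\<Sum>i\<in>A. f i) = (\<Sum>i\<in>A. Kmap n (f i))"
  by (simp_all add: Kmap_lin lin_add lin_diff lin_fsc additive.sum[OF additive_lin])

lemma Lspan_zero: "0 \<in> Lspan n"
  and Lspan_add: "x \<in> Lspan n \<Longrightarrow> y \<in> Lspan n \<Longrightarrow> x + y \<in> Lspan n"
  and Lspan_diff: "x \<in> Lspan n \<Longrightarrow> y \<in> Lspan n \<Longrightarrow> x - y \<in> Lspan n"
  and Lspan_fsc: "x \<in> Lspan n \<Longrightarrow> fsc c x \<in> Lspan n"
  and Lspan_sum: "(\<And>i. i \<in> A \<Longrightarrow> f i \<in> Lspan n) \<Longrightarrow> (\<Sum>i\<in>A. f i) \<in> Lspan n"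
  unfolding Lspan_supp by (rule supp_zero supp_add supp_diff supp_fsc supp_sum; assumption)+

text \<open>Triangularity: a word \<open>w\<close> with monomial \<open>m\<close> maps to
  \<open>m\<close> plus terms of lower degree; subtracting a preimage of those terms, available by
  induction, gives a preimage of \<open>m\<close>.\<close>

lemma Kmap_surj:
  assumes "p \<in> Cpoly n"
  shows "\<exists>x\<in>Lspan n. Kmap n x = p"
proof -
  have *: "\<exists>x\<in>Lspan n. Kmap n x = p" if "p \<in> supp (monomials n d)" for p d
    using that
  proof (induction d arbitrary: p)
    case 0
    then have "p = 0" by (auto simp: supp_def monomials_def)
    then show ?case by (intro bexI[of _ 0] Lspan_zero) (simp add: Kmap_lin)
  next
    case (Suc d)
    have "\<exists>y\<in>Lspan n. Kmap n y = Poly_Mapping.single m 1" if "m \<in> Poly_Mapping.keys p" for m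
    proof -
      have m: "m \<in> monomials n (Suc d)" by (rule suppD[OF Suc.prems that])
      then obtain w where w: "proper n w" "word_monomial w = m"
        using ex_word_monomial[of m n] by (auto simp: monomials_def)
      have "length w \<le> d" using m mdeg_word_monomial[OF w(1)] by (simp add: w(2) monomials_def)
      then have "Kword n w - Poly_Mapping.single m 1 \<in> supp (monomials n d)"
        using subsetD[OF supp_mono[OF monomials_mono] Kword_leading_term[OF w(1)]] by (simp add: w(2))
      from Suc.IH[OF this] obtain y where "y \<in> Lspan n" "Kmap n y = Kword n w - Poly_Mapping.single m 1"
        by blast
      then show ?thesis
        using supp_wd[of w "{w. proper n w}"] w(1)
        by (intro bexI[of _ "wd w - y"] Lspan_diff) (simp_all add: Kmap_diff Kmap_wd Lspan_supp)
    qed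
    then have "\<forall>m\<in>Poly_Mapping.keys p. \<exists>y. y \<in> Lspan n \<and> Kmap n y = Poly_Mapping.single m 1"
      by blast
    then obtain y where "\<forall>m\<in>Poly_Mapping.keys p. y m \<in> Lspan n \<and> Kmap n (y m) = Poly_Mapping.single m 1"
      by (rule bchoice[THEN exE])
    then have y: "y m \<in> Lspan n" "Kmap n (y m) = Poly_Mapping.single m 1" if "m \<in> Poly_Mapping.keys p" for m
      using that by blast+
    have "Kmap n (\<Sum>m\<in>Poly_Mapping.keys p. fsc (Poly_Mapping.lookup p m) (y m))
        = (\<Sum>m\<in>Poly_Mapping.keys p. Poly_Mapping.single m (Poly_Mapping.lookup p m))"
      unfolding Kmap_sum Kmap_fsc by (intro sum.cong refl) (simp add: y(2) psc_single)
    also have "\<dots> = p" by (rule poly_mapping_expand[symmetric])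
    finally show ?case
      by (rule bexI) (intro Lspan_sum Lspan_fsc y(1); assumption)
  qed
  \<comment> \<open>For \<open>p = 0\<close> the maximum is over the empty set and has no meaning,
    but then the support condition is vacuous.\<close>
  define d where "d = Suc (Max (mdeg ` Poly_Mapping.keys p))"
  have "p \<in> supp (monomials n d)"
    using assms by (auto simp: supp_def Cpoly_supp monomials_def d_def less_Suc_eq_le)
  then show ?thesis by (rule *)
qed

section \<open>Injectivity modulo the relations\<close>

definition shorter_span :: "nat \<Rightarrow> nat \<Rightarrow> falg set" where
  "shorter_span n d = {x. \<exists>y \<in> supp {w. proper n w \<and> length w < d}. x - y \<in> Iid n}"

lemma shorter_spanI: "x - y \<in> Iid n \<Longrightarrow> y \<in> supp {w. proper n w \<and> length w < d} \<Longrightarrow> x \<in> shorter_span n d"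
  by (auto simp: shorter_span_def)

lemma shorter_span_zero: "0 \<in> shorter_span n d"
  by (rule shorter_spanI[of _ 0]) (simp_all add: Iid.zero)

lemma shorter_span_add:
  assumes "x \<in> shorter_span n d" "x' \<in> shorter_span n d"
  shows "x + x' \<in> shorter_span n d"
proof -
  obtain y y' where y: "y \<in> supp {w. proper n w \<and> length w < d}" "x - y \<in> Iid n"
      "y' \<in> supp {w. proper n w \<and> length w < d}" "x' - y' \<in> Iid n"
    using assms by (auto simp: shorter_span_def)
  have "(x - y) + (x' - y') \<in> Iid n" using y by (intro Iid.add)
  then show ?thesis
    using y by (intro shorter_spanI[of _ "y + y'"] supp_add) (simp_all add: algebra_simps)
qed

lemma shorter_span_fsc:
  assumes "x \<in> shorter_span n d"
  shows "fsc c x \<in> shorter_span n d"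
proof -
  obtain y where y: "y \<in> supp {w. proper n w \<and> length w < d}" "x - y \<in> Iid n"
    using assms by (auto simp: shorter_span_def)
  then show ?thesis
    by (intro shorter_spanI[of _ "fsc c y"] supp_fsc) (simp_all add: Iid.scal flip: fsc_diff_right)
qed

lemma shorter_span_sum: "(\<And>i. i \<in> A \<Longrightarrow> f i \<in> shorter_span n d) \<Longrightarrow> (\<Sum>i\<in>A. f i) \<in> shorter_span n d"
  by (induction A rule: infinite_finite_induct) (auto intro: shorter_span_add shorter_span_zero)

text \<open>Commutativity of the associated graded algebra. All proper letters are odd, so the
  generators are even, the superbracket is the ordinary commutator, and its terms are one letter
  shorter.\<close>

lemma swap_shorter_span:
  assumes "proper n (u @ [g, h] @ v)"
  shows "wd (u @ [g, h] @ v) - wd (u @ [h, g] @ v) \<in> shorter_span n (length (u @ [g, h] @ v))"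
proof -
  obtain i j k l where gh: "g = (Lt i, Lt j)" "h = (Lt k, Lt l)"
    and ij: "i \<in> {1..n}" "j \<in> {1..n}" "k \<in> {1..n}" "l \<in> {1..n}"
    using assms by (auto simp: proper_Cons)
  define y where "y = (if j = k then wd (u @ [(Lt i, Lt l)] @ v) else 0)
     - (if i = l then wd (u @ [(Lt k, Lt j)] @ v) else 0)"
  have "y \<in> supp {w. proper n w \<and> length w < length (u @ [g, h] @ v)}"
    unfolding y_def using assms ij by (intro supp_diff) (auto simp: proper_Cons intro!: supp_wd)
  moreover have "fmul (wd u) (fmul (relator g h) (wd v)) \<in> Iid n"
    using assms proper_append[of n "[g, h]" v] by (intro Iid.gen proper_valid) auto
  then have "wd (u @ [g, h] @ v) - wd (u @ [h, g] @ v) - y \<in> Iid n"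
    unfolding gh fmul_relator by (simp add: sgn_par_def y_def if_distrib cong: if_cong)
  ultimately show ?thesis by (intro shorter_spanI)
qed

lemma move_shorter_span:
  "proper n (u @ p @ g # q) \<Longrightarrow>
    wd (u @ p @ g # q) - wd (u @ g # p @ q) \<in> shorter_span n (length (u @ p @ g # q))"
proof (induction p arbitrary: q rule: rev_induct)
  case Nil
  then show ?case by (simp add: shorter_span_zero)
next
  case (snoc x p)
  have "wd ((u @ p) @ [x, g] @ q) - wd ((u @ p) @ [g, x] @ q) \<in> shorter_span n (length ((u @ p) @ [x, g] @ q))"
    using snoc.prems by (intro swap_shorter_span) simp
  moreover have "wd (u @ p @ g # x # q) - wd (u @ g # p @ x # q) \<in> shorter_span n (length (u @ p @ g # x # q))"
    using snoc.prems by (intro snoc.IH) (auto simp: proper_Cons)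
  ultimately show ?case
    using shorter_span_add by fastforce
qed

text \<open>The head of \<open>w\<close> is pulled to the front of \<open>w'\<close> and then
  absorbed into the prefix, which is why \<open>u\<close> is kept general.\<close>

lemma permuted_shorter_span:
  "mset w = mset w' \<Longrightarrow> proper n (u @ w) \<Longrightarrow>
    wd (u @ w) - wd (u @ w') \<in> shorter_span n (length (u @ w))"
proof (induction w arbitrary: u w')
  case Nil
  then show ?case by (simp add: shorter_span_zero)
next
  case (Cons g w)
  then have "g \<in> set w'" by (metis list.set_intros(1) mset_eq_setD)
  then obtain p q where w': "w' = p @ g # q" by (meson split_list)
  have pq: "mset w = mset (p @ q)" using Cons.prems(1) by (simp add: w')
  have set: "set w' = set (g # w)" and len: "length w' = length (g # w)"
    using Cons.prems(1) by (metis mset_eq_setD, metis mset_eq_length)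
  have "proper n (u @ p @ g # q)"
    using Cons.prems(2) set unfolding w' by (simp add: proper_def)
  then have "- (wd (u @ p @ g # q) - wd (u @ g # p @ q)) \<in> shorter_span n (length (u @ g # w))"
    using shorter_span_fsc[OF move_shorter_span, of n u p g q "- 1"] len
    by (simp only: fsc_minus_one w' length_append)
  moreover have "wd ((u @ [g]) @ w) - wd ((u @ [g]) @ p @ q) \<in> shorter_span n (length ((u @ [g]) @ w))"
    using Cons.prems(2) pq by (intro Cons.IH) simp_all
  ultimately show ?case
    using shorter_span_add unfolding w' by fastforce
qed

lemma Kmap_Iid: "x \<in> Lspan n \<Longrightarrow> x \<in> Iid n \<Longrightarrow> Kmap n x = 0"
  using lin_vword_Lspan lin_vword_Iid by metis

lemma Lspan_of_supp_less: "y \<in> supp {w. proper n w \<and> length w < d} \<Longrightarrow> y \<in> Lspan n"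
  unfolding Lspan_supp by (rule subsetD[OF supp_mono]) auto

text \<open>The top degree coefficients of \<open>Kmap n x\<close> vanish, so modulo shorter words the words of
  maximal length cancel, as those with the same monomial are permutations of each other.\<close>
lemma lower_length_of_Kmap_zero:
  assumes x: "x \<in> supp {w. proper n w \<and> length w < Suc d}" and K0: "Kmap n x = 0"
  shows "x \<in> shorter_span n d"
proof -
  define c where "c = Poly_Mapping.lookup x"
  define T where "T = {w \<in> Poly_Mapping.keys x. length w = d}"
  \<comment> \<open>One word of length \<open>d\<close> is fixed for each occurring monomial; all
    others with that monomial are compared with it.\<close>
  define rep where "rep M = (SOME w. w \<in> T \<and> word_monomial w = M)" for M
  have fin: "finite T" by (simp add: T_def)
  have T: "proper n w \<and> length w = d" if "w \<in> T" for w
    using that x suppD by (fastforce simp: T_def)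
  have rep: "rep (word_monomial w) \<in> T \<and> word_monomial (rep (word_monomial w)) = word_monomial w" if "w \<in> T" for w
    unfolding rep_def using that by (rule_tac someI[of _ w]) simp
  \<comment> \<open>The coefficient of \<open>Kmap n x\<close> at \<open>M\<close>, a monomial of
    degree \<open>d\<close>: shorter words do not reach this degree, and a word of length
    \<open>d\<close> contributes through its leading term only.\<close>
  have inner: "(\<Sum>w\<in>{w \<in> T. word_monomial w = M}. c w) = 0" if M: "M \<in> word_monomial ` T" for M
  proof -
    have dM: "mdeg M = d" using M T mdeg_word_monomial by auto
    have "c w * Poly_Mapping.lookup (Kword n w) M = (if w \<in> T \<and> word_monomial w = M then c w else 0)"
      if "w \<in> Poly_Mapping.keys x" for w
    proof -
      have w: "proper n w" "length w \<le> d" using that x suppD by fastforce+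
      have "M \<notin> monomials n (length w)" using w dM by (simp add: monomials_def)
      then have "Poly_Mapping.lookup (Kword n w - Poly_Mapping.single (word_monomial w) 1) M = 0"
        using Kword_leading_term[OF w(1)] by (metis in_keys_iff suppD)
      then have "Poly_Mapping.lookup (Kword n w) M = (if word_monomial w = M then 1 else 0)"
        by (simp add: lookup_minus lookup_single when_def)
      then show ?thesis
        using mdeg_word_monomial[OF w(1)] dM that by (auto simp: T_def)
    qed
    then have "Poly_Mapping.lookup (Kmap n x) M = (\<Sum>w\<in>Poly_Mapping.keys x. if w \<in> T \<and> word_monomial w = M then c w else 0)"
      by (simp add: Kmap_def lookup_sum c_def)
    also have "\<dots> = (\<Sum>w\<in>{w \<in> T. word_monomial w = M}. c w)"
      by (simp add: sum.If_cases) (rule sum.cong, auto simp: T_def)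
    finally show ?thesis by (simp add: K0)
  qed
  have fsc_sum: "(\<Sum>w\<in>A. fsc (c w) z) = fsc (\<Sum>w\<in>A. c w) z" for A z
    by (rule poly_mapping_eqI) (simp add: lookup_sum sum_distrib_right)
  have "(\<Sum>w\<in>T. fsc (c w) (wd (rep (word_monomial w))))
     = (\<Sum>M\<in>word_monomial ` T. \<Sum>w\<in>{w \<in> T. word_monomial w = M}. fsc (c w) (wd (rep (word_monomial w))))"
    by (rule sum.image_gen[OF fin])
  also have "\<dots> = (\<Sum>M\<in>word_monomial ` T. fsc (\<Sum>w\<in>{w \<in> T. word_monomial w = M}. c w) (wd (rep M)))"
    by (simp flip: fsc_sum)
  also have "\<dots> = 0" by (simp add: inner)
  finally have cancel: "(\<Sum>w\<in>T. fsc (c w) (wd (rep (word_monomial w)))) = 0" .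
  have "x = (\<Sum>w\<in>Poly_Mapping.keys x. fsc (c w) (wd w))"
    unfolding c_def by (rule falg_expand)
  also have "\<dots> = (\<Sum>w\<in>T. fsc (c w) (wd w)) + (\<Sum>w\<in>Poly_Mapping.keys x - T. fsc (c w) (wd w))"
    by (subst sum.subset_diff[of T]) (auto simp: T_def)
  \<comment> \<open>The representatives may be subtracted freely, their weighted sum being
    0.\<close>
  also have "(\<Sum>w\<in>T. fsc (c w) (wd w)) = (\<Sum>w\<in>T. fsc (c w) (wd w - wd (rep (word_monomial w))))"
    by (simp add: fsc_diff_right sum_subtractf cancel)
  finally have x_eq: "x = (\<Sum>w\<in>T. fsc (c w) (wd w - wd (rep (word_monomial w)))) + (\<Sum>w\<in>Poly_Mapping.keys x - T. fsc (c w) (wd w))" .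
  have "wd w - wd (rep (word_monomial w)) \<in> shorter_span n d" if "w \<in> T" for w
  proof -
    have "mset w = mset (rep (word_monomial w))"
      using T rep[OF that] that by (intro mset_eq_of_word_monomial_eq[of n]) auto
    then show ?thesis
      using permuted_shorter_span[of w _ n "[]"] T[OF that] by simp
  qed
  then have 1: "(\<Sum>w\<in>T. fsc (c w) (wd w - wd (rep (word_monomial w)))) \<in> shorter_span n d"
    by (intro shorter_span_sum shorter_span_fsc)
  have 2: "(\<Sum>w\<in>Poly_Mapping.keys x - T. fsc (c w) (wd w)) \<in> shorter_span n d"
  proof (rule shorter_spanI)
    show "(\<Sum>w\<in>Poly_Mapping.keys x - T. fsc (c w) (wd w)) \<in> supp {w. proper n w \<and> length w < d}"
      using x by (intro supp_sum supp_fsc supp_wd) (force simp: T_def dest: suppD)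
  qed (simp add: Iid.zero)
  show ?thesis
    by (subst x_eq) (rule shorter_span_add[OF 1 2])
qed

text \<open>Descent on the length: \<open>x\<close> is congruent to a combination \<open>y\<close>
  of shorter words, and \<open>y\<close> is again in the kernel because the Koszul map vanishes on
  \<open>x - y\<close>.\<close>

lemma Iid_of_Kmap_zero:
  assumes "x \<in> Lspan n" "Kmap n x = 0"
  shows "x \<in> Iid n"
proof -
  have *: "x \<in> Iid n" if "x \<in> supp {w. proper n w \<and> length w < d}" "Kmap n x = 0" for d x
    using that
  proof (induction d arbitrary: x)
    case 0
    then have "x = 0" by (simp add: supp_def)
    then show ?case by (simp add: Iid.zero)
  next
    case (Suc d)
    have "x \<in> shorter_span n d" using Suc.prems by (rule lower_length_of_Kmap_zero)
    then obtain y where y: "y \<in> supp {w. proper n w \<and> length w < d}" "x - y \<in> Iid n"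
      unfolding shorter_span_def by blast
    have "x - y \<in> Lspan n"
      using Suc.prems(1) y(1) by (intro Lspan_diff Lspan_of_supp_less)
    then have "Kmap n y = 0"
      using Kmap_Iid[OF _ y(2)] Suc.prems(2) by (simp add: Kmap_diff)
    then have "y \<in> Iid n" using y(1) Suc.IH by blast
    then show ?case using Iid.add[OF y(2)] by fastforce
  qed
  have "x \<in> supp {w. proper n w \<and> length w < Suc (Max (length ` Poly_Mapping.keys x))}"
    using assms(1) by (auto simp: Lspan_supp supp_def less_Suc_eq_le)
  then show ?thesis using * assms(2) by blast
qed

lemma Kmap_eq_iff:
  assumes "x \<in> Lspan n" "y \<in> Lspan n"
  shows "Kmap n x = Kmap n y \<longleftrightarrow> x - y \<in> Iid n"
  using Iid_of_Kmap_zero[of "x - y" n] Kmap_Iid[of "x - y" n] Lspan_diff[OF assms]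
  by (auto simp: Kmap_diff)

section \<open>Existence of the projection\<close>

text \<open>Membership in the preimage of \<open>Virt\<close>, the sum of U(gl(n)) and
  \<open>Irr\<close>.\<close>

definition projectable :: "nat \<Rightarrow> falg \<Rightarrow> bool" where
  "projectable n x \<longleftrightarrow> (\<exists>u. represents_proj n x u)"

lemma projectable_Irr: "x \<in> Irr n \<Longrightarrow> projectable n x"
  unfolding projectable_def represents_proj_def using Lspan_zero by (intro exI[of _ 0]) simp

lemma projectable_Lspan: "x \<in> Lspan n \<Longrightarrow> projectable n x"
  unfolding projectable_def represents_proj_def
  using Irr.ideal[OF Iid.zero] by (intro exI[of _ x]) simp

lemma projectable_add:
  assumes "projectable n x" "projectable n y"
  shows "projectable n (x + y)"
proof -
  obtain u w where "u \<in> Lspan n" "x - u \<in> Irr n" "w \<in> Lspan n" "y - w \<in> Irr n"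
    using assms by (auto simp: projectable_def represents_proj_def)
  then show ?thesis
    unfolding projectable_def represents_proj_def
    using Irr.add[of "x - u" n "y - w"] Lspan_add[of u n w]
    by (intro exI[of _ "u + w"]) (simp add: algebra_simps)
qed

lemma projectable_fsc:
  assumes "projectable n x"
  shows "projectable n (fsc c x)"
proof -
  obtain u where "u \<in> Lspan n" "x - u \<in> Irr n"
    using assms by (auto simp: projectable_def represents_proj_def)
  then show ?thesis
    unfolding projectable_def represents_proj_def
    using Irr.scal[of "x - u" n c] Lspan_fsc[of u n c]
    by (intro exI[of _ "fsc c u"]) (simp add: fsc_diff_right)
qed

lemma projectable_swap:
  assumes "valid_word n (p @ [(a, b), (c, d)] @ q)"
    and swapped: "projectable n (wd (p @ [(c, d), (a, b)] @ q))"
    and shorter: "b = c \<Longrightarrow> projectable n (wd (p @ [(a, d)] @ q))" "a = d \<Longrightarrow> projectable n (wd (p @ [(c, b)] @ q))"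
  shows "projectable n (wd (p @ [(a, b), (c, d)] @ q))"
proof -
  let ?s = "sgn_par (a, b) (c, d)"
  let ?x = "if b = c then wd (p @ [(a, d)] @ q) else 0"
  let ?y = "if a = d then wd (p @ [(c, b)] @ q) else 0"
  have z: "projectable n 0" by (rule projectable_Lspan[OF Lspan_zero])
  have "fmul (wd p) (fmul (relator (a, b) (c, d)) (wd q)) \<in> Iid n"
    using assms(1) by (intro Iid.gen) (auto simp: valid_word_def)
  then have "projectable n (fmul (wd p) (fmul (relator (a, b) (c, d)) (wd q)))"
    by (intro projectable_Irr Irr.ideal)
  moreover have "projectable n (fsc ?s (wd (p @ [(c, d), (a, b)] @ q)))"
    by (rule projectable_fsc[OF swapped])
  moreover have "projectable n ?x" "projectable n (fsc (- ?s) ?y)"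
    using shorter z by (auto intro: projectable_fsc)
  ultimately have sum: "projectable n (fmul (wd p) (fmul (relator (a, b) (c, d)) (wd q))
      + fsc ?s (wd (p @ [(c, d), (a, b)] @ q)) + ?x + fsc (- ?s) ?y)"
    by (intro projectable_add)
  have "A = (A - S - (X - fsc ?s Y)) + S + X + fsc (- ?s) Y" for A S X Y
    by (rule poly_mapping_eqI) (simp add: lookup_add lookup_minus)
  from this[of "wd (p @ [(a, b), (c, d)] @ q)"]
  have eq: "wd (p @ [(a, b), (c, d)] @ q) = fmul (wd p) (fmul (relator (a, b) (c, d)) (wd q))
      + fsc ?s (wd (p @ [(c, d), (a, b)] @ q)) + ?x + fsc (- ?s) ?y"
    unfolding fmul_relator .
  show ?thesis by (subst eq) (rule sum)
qed

text \<open>Weight zero for every virtual letter. Exchanges and contractions preserve it, and it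
  excludes words that create virtual letters without ever removing them.\<close>

definition balanced :: "gen list \<Rightarrow> bool" where
  "balanced w = (\<forall>\<gamma>. virtual \<gamma> \<longrightarrow> count_fst \<gamma> w = count_snd \<gamma> w)"

lemma balanced_swap:
  assumes "balanced (p @ [g, h] @ q)"
  shows "balanced (p @ [h, g] @ q)"
proof -
  have "count_fst \<gamma> (p @ [h, g] @ q) = count_fst \<gamma> (p @ [g, h] @ q)"
    "count_snd \<gamma> (p @ [h, g] @ q) = count_snd \<gamma> (p @ [g, h] @ q)" for \<gamma>
    by simp_all
  then show ?thesis using assms unfolding balanced_def by presburger
qed

lemma balanced_contract:
  assumes "balanced (p @ [(a, b), (b, d)] @ q)"
  shows "balanced (p @ [(a, d)] @ q)"
proof -
  have "count_fst \<gamma> (p @ [(a, b), (b, d)] @ q) = count_fst \<gamma> (p @ [(a, d)] @ q) + (if b = \<gamma> then 1 else 0)"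
    "count_snd \<gamma> (p @ [(a, b), (b, d)] @ q) = count_snd \<gamma> (p @ [(a, d)] @ q) + (if b = \<gamma> then 1 else 0)" for \<gamma>
    by simp_all
  then show ?thesis using assms unfolding balanced_def by (metis add_right_cancel)
qed

lemma valid_word_append [simp]: "valid_word n (u @ w) \<longleftrightarrow> valid_word n u \<and> valid_word n w"
  by (simp add: valid_word_def ball_Un)

lemma valid_word_Cons: "valid_word n ((a, b) # w) \<longleftrightarrow> valid_letter n a \<and> valid_letter n b \<and> valid_word n w"
  by (simp add: valid_word_def)

text \<open>A generator annihilating a virtual letter is moved to the right end, where the word becomes
  irregular; the commutators are shorter and still balanced.\<close>
lemma projectable_balanced:
  "valid_word n w \<Longrightarrow> balanced w \<Longrightarrow> projectable n (wd w)"
proof (induction "length w" arbitrary: w rule: less_induct)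
  case less
  show ?case
  proof (cases "\<exists>g\<in>set w. virtual (snd g)")
    case False
    \<comment> \<open>No virtual letter is removed, so by balance none is created either and the
      word is proper.\<close>
    have "\<not> virtual a \<and> \<not> virtual b" if "(a, b) \<in> set w" for a b
    proof
      show "\<not> virtual b" using False that by force
      show "\<not> virtual a"
      proof
        assume v: "virtual a"
        have "\<forall>g\<in>set w. snd g \<noteq> a" using False v by blast
        then have "count_snd a w = 0" by (simp add: filter_empty_conv)
        moreover have "count_fst a w = count_snd a w"
          using less.prems(2) v unfolding balanced_def by blast
        ultimately have "count_fst a w = 0" by (rule trans[rotated])
        then have "filter (\<lambda>g. fst g = a) w = []" by (rule iffD1[OF length_0_conv])
        then have "\<forall>g\<in>set w. fst g \<noteq> a" unfolding filter_empty_conv .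
        then show False using that by auto
      qed
    qed
    moreover have "valid_letter n a \<and> valid_letter n b" if "(a, b) \<in> set w" for a b
      using less.prems(1) that by (auto simp: valid_word_def)
    moreover have "\<exists>i. c = Lt i \<and> 1 \<le> i \<and> i \<le> n" if "\<not> virtual c" "valid_letter n c" for c
      using that by (cases c) auto
    ultimately have "proper n w"
      unfolding proper_def by blast
    then show ?thesis by (intro projectable_Lspan) (simp add: Lspan_supp supp_wd)
  next
    case True
    \<comment> \<open>The inner induction is on the part \<open>q\<close> to the right of
      \<open>g\<close>, at fixed length; contractions shorten the word and fall under the outer
      induction.\<close>
    have "projectable n (wd (p @ g # q))"
      if "length (p @ g # q) = length w" "valid_word n (p @ g # q)" "balanced (p @ g # q)" "virtual (snd g)" for p g q
      using that
    proof (induction q arbitrary: p)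
      case Nil
      \<comment> \<open>Irregularity occurs already at position 1: nothing stands to the right of
        \<open>g\<close> that could have created the letter it removes.\<close>
      have "irregular (p @ [g])"
        unfolding irregular_def using Nil.prems(4) by (intro exI[of _ 1] exI[of _ "snd g"]) simp
      then have "wd ([] @ p @ [g]) \<in> Irr n"
        using Nil.prems(2) by (intro Irr.gen) (simp_all add: valid_word_def)
      then show ?case by (simp add: projectable_Irr)
    next
      case (Cons h q)
      obtain a b c d where gh: "g = (a, b)" "h = (c, d)" by (metis surj_pair)
      have len: "length (p @ [(a, b), (c, d)] @ q) = length w"
        and val: "valid_word n (p @ [(a, b), (c, d)] @ q)"
        and bal: "balanced (p @ [(a, b), (c, d)] @ q)"
        using Cons.prems(1-3) by (simp_all only: gh append.simps)
      have bal': "balanced (p @ [(c, d), (a, b)] @ q)" by (rule balanced_swap[OF bal])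
      have "projectable n (wd ((p @ [h]) @ g # q))"
        using len val bal' Cons.prems(4) by (intro Cons.IH) (simp_all add: gh valid_word_Cons)
      moreover have "projectable n (wd (p @ [(a, d)] @ q))" if "b = c"
        using len val balanced_contract[OF bal[unfolded that]]
        by (intro less.hyps) (simp_all add: valid_word_Cons)
      moreover have "projectable n (wd (p @ [(c, b)] @ q))" if "a = d"
        using len val balanced_contract[OF bal'[unfolded that]]
        by (intro less.hyps) (simp_all add: valid_word_Cons)
      ultimately show ?case
        using projectable_swap[of n p a b c d q] Cons.prems(2) by (simp add: gh)
    qed
    moreover obtain p g q where "w = p @ g # q" "virtual (snd g)"
      using True by (meson split_list)
    ultimately show ?thesis using less.prems by blast
  qed
qed

context virtual_alphabet
begin

lemma balanced_virt_word:
  assumes "map length S = map length T"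
  shows "balanced (virt_word v S T)"
  unfolding balanced_def
proof (intro allI impI)
  fix \<gamma> assume \<gamma>: "virtual \<gamma>"
  have len: "length S = length T" "\<And>r. r < length T \<Longrightarrow> length (S ! r) = length (T ! r)"
    using assms map_eq_imp_length_eq by (metis, metis nth_map map_eq_imp_length_eq)
  have [simp]: "Lt s \<noteq> \<gamma>" for s using \<gamma> by auto
  have [simp]: "length (filter (\<lambda>_. P) xs) = (if P then length xs else 0)" for P and xs :: "'a list"
    by simp
  have "m \<le> length T \<Longrightarrow>
      count_snd \<gamma> (concat (map (\<lambda>r. map (\<lambda>s. (Lt s, v (Suc r))) (S ! r)) [0..<m]))
    = count_fst \<gamma> (concat (map (\<lambda>r. map (\<lambda>t. (v (Suc r), Lt t)) (T ! r)) [0..<m]))" for m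
    by (induction m) (simp_all add: filter_map comp_def len)
  moreover have "count_fst \<gamma> (concat (map (\<lambda>r. map (\<lambda>s. (Lt s, v (Suc r))) (S ! r)) [0..<m])) = 0"
    "count_snd \<gamma> (concat (map (\<lambda>r. map (\<lambda>t. (v (Suc r), Lt t)) (T ! r)) [0..<m])) = 0" for m
    by (induction m) (simp_all add: filter_map comp_def)
  ultimately show "count_fst \<gamma> (virt_word v S T) = count_snd \<gamma> (virt_word v S T)"
    by (simp add: virt_word_def len(1))
qed

lemma valid_virt_word:
  assumes "tableau_on n S" "tableau_on n T" "length S = length T"
  shows "valid_word n (virt_word v S T)"
proof -
  have "valid_letter n (v r)" for r using virt[of r] by (cases "v r") auto
  moreover have "set (S ! r) \<subseteq> {1..n}" "set (T ! r) \<subseteq> {1..n}" if "r < length S" for r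
    using assms that nth_mem unfolding tableau_on_def by metis+
  ultimately show ?thesis
    using assms(3) by (fastforce simp: valid_word_def virt_word_def)
qed

end

section \<open>The maps inverse to the Koszul map\<close>

lemma one_column_tableau:
  assumes "set xs \<subseteq> {1..n}"
  shows "tableau_on n (map (\<lambda>x. [x]) xs)"
  using assms by (auto simp: tableau_on_def sorted_wrt_iff_nth_less)

text \<open>Tableaux with a single column give all monomials up to sign.\<close>
lemma one_column_product:
  "proper n w \<Longrightarrow> (\<Prod>r<length w. Var (map (\<lambda>g. case g of (Lt i, b) \<Rightarrow> i) w ! r) (map (\<lambda>g. case g of (a, Lt j) \<Rightarrow> j) w ! r))
     = Poly_Mapping.single (word_monomial w) 1"
proof (induction w)
  case (Cons g w)
  then obtain i j where "g = (Lt i, Lt j)" "proper n w" by (auto simp: proper_Cons)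
  then show ?case
    using Cons.IH by (simp add: prod.lessThan_Suc_shift Var_def mult_single del: prod.lessThan_Suc)
qed simp

lemma ex_one_column:
  assumes "Poly_Mapping.keys m \<subseteq> {1..n} \<times> {1..n}"
  obtains xs ys where "length xs = length ys" "set xs \<subseteq> {1..n}" "set ys \<subseteq> {1..n}"
    "(\<Prod>r<length xs. Var (xs ! r) (ys ! r)) = Poly_Mapping.single m 1"
proof -
  obtain w where w: "proper n w" "word_monomial w = m"
    using ex_word_monomial[OF assms] by blast
  show thesis
  proof
    show "(\<Prod>r<length (map (\<lambda>g. case g of (Lt i, b) \<Rightarrow> i) w).
        Var (map (\<lambda>g. case g of (Lt i, b) \<Rightarrow> i) w ! r) (map (\<lambda>g. case g of (a, Lt j) \<Rightarrow> j) w ! r))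
      = Poly_Mapping.single m 1"
      using one_column_product[OF w(1)] by (simp only: length_map w(2))
  qed (use w(1) in \<open>fastforce simp: proper_def\<close>)+
qed

text \<open>For rows of length 1 only the sign between rows survives. The condition
  \<open>c * c = 1\<close> records that it can be undone by multiplying with \<open>c\<close>
  again.\<close>

lemma bitab_one_column:
  assumes "length xs = length ys"
  shows "\<exists>c. c * c = 1 \<and> bitab (map (\<lambda>x. [x]) xs) (map (\<lambda>y. [y]) ys) = psc c (\<Prod>r<length xs. Var (xs ! r) (ys ! r))"
proof -
  have "biprod [i] [j] = Var i j" for i j
    by (simp add: biprod_def det_var_def lessThan_Suc numeral_2_eq_2)
  then have "bitab (map (\<lambda>x. [x]) xs) (map (\<lambda>y. [y]) ys) =
      (- 1) ^ (\<Sum>k<length xs. length (map (\<lambda>x. [x]) xs ! k) * (\<Sum>l<k. length (map (\<lambda>y. [y]) ys ! l)))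
      * (\<Prod>r<length xs. Var (xs ! r) (ys ! r))" (is "_ = (- 1) ^ ?N * ?p")
    using assms by (simp add: bitab_def)
  moreover have "(- 1) ^ N * p = psc ((- 1) ^ N) p" for N and p :: cpoly
    by (cases "even N") (simp_all add: psc_minus_one)
  ultimately show ?thesis
    by (intro exI[of _ "(- 1) ^ ?N"]) (simp add: flip: power_mult_distrib)
qed

lemma bitab_star_one_column:
  assumes "length xs = length ys"
  shows "bitab_star (map (\<lambda>x. [x]) xs) (map (\<lambda>y. [y]) ys) = (\<Prod>r<length xs. Var (xs ! r) (ys ! r))"
  using assms by (simp add: bitab_star_def per_var_def lessThan_Suc)

text \<open>The two facts that make the inversion work: the virtual word of a bitableau evaluates to
  it on the vacuum, and single columns give all monomials up to an invertible sign.\<close>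

locale bitableau_family = virtual_alphabet v e for v e +
  fixes n :: nat and bt :: "nat list list \<Rightarrow> nat list list \<Rightarrow> cpoly"
  assumes vword_bt: "tableau_on n T \<Longrightarrow> map length S = map length T \<Longrightarrow> vword n (virt_word v S T) = bt S T"
    and bt_one_column: "length xs = length ys \<Longrightarrow>
      \<exists>c. c * c = 1 \<and> bt (map (\<lambda>x. [x]) xs) (map (\<lambda>y. [y]) ys) = psc c (\<Prod>r<length xs. Var (xs ! r) (ys ! r))"
begin

lemma Kmap_of_represents_bt:
  assumes "tableau_on n T" "map length S = map length T" "represents_proj n (wd (virt_word v S T)) u"
  shows "Kmap n u = bt S T"
  using Kmap_eq_of_represents_proj[OF assms(3)] vword_bt[OF assms(1,2)] by simp

text \<open>Any choice of preimages under the Koszul map is linear modulo \<open>Iid n\<close> by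
  injectivity. Its value at \<open>bt S T\<close> has the same Koszul image as the projection of the
  virtual word, so it represents that projection too.\<close>

lemma ex_Bmap: "\<exists>B. is_Bmap n v bt B"
proof -
  define B where "B p = (SOME x. x \<in> Lspan n \<and> Kmap n x = p)" for p
  have B: "B p \<in> Lspan n \<and> Kmap n (B p) = p" if "p \<in> Cpoly n" for p
    unfolding B_def by (rule someI_ex) (use Kmap_surj[OF that] in blast)
  have "is_Bmap n v bt B"
    unfolding is_Bmap_def
  proof (intro conjI ballI allI impI)
    fix p q c d assume pq: "p \<in> Cpoly n" "q \<in> Cpoly n"
    then have "psc c p + psc d q \<in> Cpoly n"
      unfolding Cpoly_supp by (intro supp_add supp_psc)
    then show "B (psc c p + psc d q) - (fsc c (B p) + fsc d (B q)) \<in> Iid n"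
      using B pq by (subst Kmap_eq_iff[symmetric]) (simp_all add: Lspan_add Lspan_fsc Kmap_add Kmap_fsc)
  next
    fix S T assume ST: "tableau_on n S" "tableau_on n T" "map length S = map length T"
    then have "length S = length T" by (intro map_eq_imp_length_eq)
    then have "projectable n (wd (virt_word v S T))"
      using ST by (intro projectable_balanced valid_virt_word balanced_virt_word)
    then obtain u where u: "represents_proj n (wd (virt_word v S T)) u"
      by (auto simp: projectable_def)
    then have uL: "u \<in> Lspan n" by (simp add: represents_proj_def)
    have Ku: "Kmap n u = bt S T" using ST(2,3) u by (rule Kmap_of_represents_bt)
    then have bt: "bt S T \<in> Cpoly n" using Kmap_Cpoly[OF uL] by simp
    have "u - B (bt S T) \<in> Iid n"
      using Kmap_eq_iff[OF uL, of "B (bt S T)"] B[OF bt] Ku by simp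
    then have "u - B (bt S T) \<in> Irr n" by (rule Irr.ideal)
    moreover have "wd (virt_word v S T) - u \<in> Irr n"
      using u by (simp add: represents_proj_def)
    ultimately have "(wd (virt_word v S T) - u) + (u - B (bt S T)) \<in> Irr n"
      by (rule Irr.add[rotated])
    then show "represents_proj n (wd (virt_word v S T)) (B (bt S T))"
      using B[OF bt] by (simp add: represents_proj_def)
  qed (use B in blast)
  then show ?thesis by blast
qed

text \<open>The composite is linear on the nose, since the Koszul map kills \<open>Iid n\<close>,
  and it fixes the single-column bitableaux, hence all monomials.\<close>

lemma Kmap_Bmap:
  assumes B: "is_Bmap n v bt B" and p: "p \<in> Cpoly n"
  shows "Kmap n (B p) = p"
proof -
  have BL: "B q \<in> Lspan n" if "q \<in> Cpoly n" for q
    using B that by (simp add: is_Bmap_def)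
  have C: "psc c q + psc d r \<in> Cpoly n" if "q \<in> Cpoly n" "r \<in> Cpoly n" for c d q r
    using that unfolding Cpoly_supp by (intro supp_add supp_psc)
  have linear: "Kmap n (B (psc c q + psc d r)) = psc c (Kmap n (B q)) + psc d (Kmap n (B r))"
    if "q \<in> Cpoly n" "r \<in> Cpoly n" for c d q r
  proof -
    have "B (psc c q + psc d r) - (fsc c (B q) + fsc d (B r)) \<in> Iid n"
      using B that unfolding is_Bmap_def by blast
    then have "Kmap n (B (psc c q + psc d r)) = Kmap n (fsc c (B q) + fsc d (B r))"
      using that by (subst Kmap_eq_iff) (auto intro!: BL C Lspan_add Lspan_fsc)
    then show ?thesis by (simp add: Kmap_add Kmap_fsc)
  qed
  have zero: "0 \<in> Cpoly n" by (simp add: Cpoly_supp)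
  \<comment> \<open>\<open>B 0\<close> itself is only congruent to 0.\<close>
  have K0: "Kmap n (B 0) = 0" using linear[OF zero zero, of 0 0] by simp
  have single: "Poly_Mapping.single m c \<in> Cpoly n \<and> Kmap n (B (Poly_Mapping.single m c)) = Poly_Mapping.single m c"
    if "m \<in> Poly_Mapping.keys p" for m c
  proof -
    have m: "Poly_Mapping.keys m \<subseteq> {1..n} \<times> {1..n}"
      using suppD[OF p[unfolded Cpoly_supp] that] by simp
    obtain xs ys where xy: "length xs = length ys" "set xs \<subseteq> {1..n}" "set ys \<subseteq> {1..n}"
      "(\<Prod>r<length xs. Var (xs ! r) (ys ! r)) = Poly_Mapping.single m 1"
      using ex_one_column[OF m] .
    let ?S = "map (\<lambda>x. [x]) xs" and ?T = "map (\<lambda>y. [y]) ys"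
    obtain s where s: "s * s = 1" "bt ?S ?T = Poly_Mapping.single m s"
      using bt_one_column[OF xy(1)] by (auto simp: xy(4) psc_single)
    have T: "tableau_on n ?S" "tableau_on n ?T" "map length ?S = map length ?T"
      using xy by (simp_all add: one_column_tableau comp_def map_replicate_const)
    then have "represents_proj n (wd (virt_word v ?S ?T)) (B (bt ?S ?T))"
      using B unfolding is_Bmap_def by blast
    then have K: "Kmap n (B (Poly_Mapping.single m s)) = Poly_Mapping.single m s"
      using Kmap_of_represents_bt[OF T(2,3)] by (simp add: s(2))
    have mem: "Poly_Mapping.single m d \<in> Cpoly n" for d
      using m unfolding Cpoly_supp by (intro supp_single) simp
    \<comment> \<open>Scaling by \<open>c * s\<close> turns coefficient \<open>s\<close> into
      \<open>c\<close>, as \<open>s * s = 1\<close>.\<close>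
    have "Kmap n (B (Poly_Mapping.single m c)) = Poly_Mapping.single m c"
      using linear[OF mem[of s] zero, of "c * s" 0] by (simp add: K K0 psc_single s(1) mult.assoc)
    then show ?thesis using mem by blast
  qed
  \<comment> \<open>Linearity is available only for two summands inside \<open>Cpoly n\<close>, so
    membership is carried along in the induction over sets of monomials.\<close>
  have "(\<Sum>m\<in>A. Poly_Mapping.single m (Poly_Mapping.lookup p m)) \<in> Cpoly n \<and>
      Kmap n (B (\<Sum>m\<in>A. Poly_Mapping.single m (Poly_Mapping.lookup p m)))
        = (\<Sum>m\<in>A. Poly_Mapping.single m (Poly_Mapping.lookup p m))"
    if "A \<subseteq> Poly_Mapping.keys p" for A
    using finite_subset[OF that finite_keys] that
  proof (induction A rule: finite_induct)
    case empty
    then show ?case by (simp add: zero K0)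
  next
    case (insert m A)
    let ?s = "Poly_Mapping.single m (Poly_Mapping.lookup p m)"
    let ?q = "\<Sum>m\<in>A. Poly_Mapping.single m (Poly_Mapping.lookup p m)"
    have 1: "?s \<in> Cpoly n" "Kmap n (B ?s) = ?s" using single[of m] insert.prems by auto
    have 2: "?q \<in> Cpoly n" "Kmap n (B ?q) = ?q" using insert.IH insert.prems by auto
    show ?case
      using C[OF 1(1) 2(1), of 1 1] linear[OF 1(1) 2(1), of 1 1] insert.hyps 1(2) 2(2) by simp
  qed
  then show ?thesis
    using poly_mapping_expand[of p] by (metis order_refl)
qed

lemma Bmap_Kmap:
  assumes B: "is_Bmap n v bt B" and x: "x \<in> Lspan n"
  shows "B (Kmap n x) - x \<in> Iid n"
proof -
  have C: "Kmap n x \<in> Cpoly n" by (rule Kmap_Cpoly[OF x])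
  then have "B (Kmap n x) \<in> Lspan n" using B by (simp add: is_Bmap_def)
  then show ?thesis using Kmap_eq_iff[OF _ x] Kmap_Bmap[OF B C] by blast
qed

end

lemma bitableau_family_Alpha: "bitableau_family Alpha (- 1) n bitab"
  by (intro bitableau_family.intro bitableau_family_axioms.intro Alpha.virtual_alphabet_axioms
      vword_Alpha bitab_one_column)

lemma bitableau_family_Beta: "bitableau_family Beta 1 n bitab_star"
  by (intro bitableau_family.intro bitableau_family_axioms.intro Beta.virtual_alphabet_axioms
      vword_Beta exI[of _ 1]) (simp_all add: bitab_star_one_column)

theorem mainTheorem9:
  fixes n :: nat
  shows
   "(\<forall>x\<in>Lspan n. Kmap n x \<in> Cpoly n) \<and>
    (\<forall>x\<in>Lspan n. \<forall>y\<in>Lspan n. Kmap n x = Kmap n y \<longleftrightarrow> x - y \<in> Iid n) \<and>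
    (\<forall>p\<in>Cpoly n. \<exists>x\<in>Lspan n. Kmap n x = p) \<and>
    (\<exists>B. is_Bmap n Alpha bitab B) \<and>
    (\<exists>B. is_Bmap n Beta bitab_star B) \<and>
    (\<forall>B. is_Bmap n Alpha bitab B \<longrightarrow>
       (\<forall>p\<in>Cpoly n. Kmap n (B p) = p) \<and> (\<forall>x\<in>Lspan n. B (Kmap n x) - x \<in> Iid n)) \<and>
    (\<forall>B. is_Bmap n Beta bitab_star B \<longrightarrow>
       (\<forall>p\<in>Cpoly n. Kmap n (B p) = p) \<and> (\<forall>x\<in>Lspan n. B (Kmap n x) - x \<in> Iid n)) \<and>
    (\<forall>B B'. is_Bmap n Alpha bitab B \<longrightarrow> is_Bmap n Beta bitab_star B' \<longrightarrow>
       (\<forall>p\<in>Cpoly n. B p - B' p \<in> Iid n))"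
proof -
  interpret A: bitableau_family Alpha "- 1" n bitab by (rule bitableau_family_Alpha)
  interpret B: bitableau_family Beta 1 n bitab_star by (rule bitableau_family_Beta)
  have "B p - B' p \<in> Iid n"
    if "is_Bmap n Alpha bitab B" "is_Bmap n Beta bitab_star B'" "p \<in> Cpoly n" for B B' p
  proof -
    have "B p \<in> Lspan n" "B' p \<in> Lspan n" using that by (simp_all add: is_Bmap_def)
    then show ?thesis
      using Kmap_eq_iff A.Kmap_Bmap B.Kmap_Bmap that by metis
  qed
  then show ?thesis
    using Kmap_Cpoly Kmap_eq_iff Kmap_surj A.ex_Bmap B.ex_Bmap A.Kmap_Bmap B.Kmap_Bmap
      A.Bmap_Kmap B.Bmap_Kmap by (intro conjI ballI allI impI) blast+
qed

end
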